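(* Let $\mathbf X=(X_t)_{t\in I}$ be an OPM process with orthogonal polynomial martingales $\{p_n(x;t)\}_{n\ge0}$, one-dimensional laws $\mu(\cdot,t)$ and transition laws $\eta(\cdot,t;y,s)$, and assume that for all $s<t$ in $I$ and $y\in\operatorname{supp}\mu(\cdot,s)$ one has $\eta(\cdot,t;y,s)\ll\mu(\cdot,t)$ with Radon–Nikodym derivative $\phi(x,t;y,s)$ satisfying $\int\phi(x,t;y,s)^2\mu(dx,t)<\infty$. Then for all $s<t$ in $I$, $$\eta(dx,t;y,s)=\mu(dx,t)\sum_{n\ge0}\frac{1}{\hat p_n(t)}p_n(x;t)p_n(y;s),$$ i.e. $\phi(x,t;y,s)=\sum_{n\ge0}p_n(x;t)p_n(y;s)/\hat p_n(t)$ with convergence in $L_2(\mu(\cdot,t))$. Moreover, for $\mu(\cdot,s)$-almost every $y$, $\sum_{n\ge0}p_n^2(y;s)/\hat p_n(t)<\infty$.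
   Context: $I$ is a segment of the real line; $\mathbf X$ is a real Markov process with all moments finite, infinite support of every $X_t$, and each one-dimensional law determined by its moments; $\mathcal F_{\le s}=\sigma(X_v:v\in I,v\le s)$. $\mu(\cdot,t)$ is the law of $X_t$ and $\eta(\cdot,t;y,s)$ the transition law $P(X_t\in\cdot\mid X_s=y)$. $\mathbf X$ is an OPM process if it is an MPR process (for every $n$ and $s\le t$, $E(X_t^n\mid\mathcal F_{\le s})$ is a polynomial of degree at most $n$ in $X_s$, together with the non-degeneracy and continuity conditions of the MPR class) and there exist polynomials $p_n(x;t)$ of degree $n$ in $x$, $p_0=1$, such that $E p_n(X_t;t)p_m(X_t;t)=\hat p_n(t)\delta_{n,m}$ and $E(p_n(X_t;t)\mid\mathcal F_{\le s})=p_n(X_s;s)$ a.s. for all $s\le t$, $n,m\ge0$. *)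

theory Defs
  imports "HOL-Probability.Probability" "HOL-Computational_Algebra.Polynomial"
begin

definition past_algebra :: "'a measure \<Rightarrow> real set \<Rightarrow> (real \<Rightarrow> 'a \<Rightarrow> real) \<Rightarrow> real \<Rightarrow> 'a measure" where
  "past_algebra M I X s =
     sigma (space M) (\<Union>v\<in>{v\<in>I. v \<le> s}. {X v -` A \<inter> space M | A. A \<in> sets borel})"

definition law :: "'a measure \<Rightarrow> (real \<Rightarrow> 'a \<Rightarrow> real) \<Rightarrow> real \<Rightarrow> real measure" where
  "law M X t = distr M borel (X t)"

definition msupp :: "real measure \<Rightarrow> real set" where
  "msupp \<nu> = {x. \<forall>U. open U \<longrightarrow> x \<in> U \<longrightarrow> emeasure \<nu> U > 0}"

definition moment_determinate :: "real measure \<Rightarrow> bool" where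
  "moment_determinate \<mu> \<longleftrightarrow>
     (\<forall>\<nu>. prob_space \<nu> \<longrightarrow> sets \<nu> = sets borel \<longrightarrow>
        (\<forall>n::nat. integrable \<nu> (\<lambda>x. x ^ n)) \<longrightarrow>
        (\<forall>n::nat. (\<integral>x. x ^ n \<partial>\<nu>) = (\<integral>x. x ^ n \<partial>\<mu>)) \<longrightarrow> \<nu> = \<mu>)"

definition markov_process ::
  "'a measure \<Rightarrow> real set \<Rightarrow> (real \<Rightarrow> 'a \<Rightarrow> real) \<Rightarrow> (real \<Rightarrow> real \<Rightarrow> real \<Rightarrow> real measure) \<Rightarrow> bool" where
  "markov_process M I X \<eta> \<longleftrightarrow>
     prob_space M \<and>
     (\<forall>t\<in>I. X t \<in> borel_measurable M) \<and>
     (\<forall>s\<in>I. \<forall>t\<in>I. s \<le> t \<longrightarrow>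
        (\<forall>y. prob_space (\<eta> t y s) \<and> sets (\<eta> t y s) = sets borel) \<and>
        (\<forall>B\<in>sets borel.
           (\<lambda>y. measure (\<eta> t y s) B) \<in> borel_measurable borel \<and>
           (AE \<omega> in M. real_cond_exp M (past_algebra M I X s) (\<lambda>\<omega>. indicator B (X t \<omega>)) \<omega>
                        = measure (\<eta> t (X s \<omega>) s) B)))"

definition standing_assms :: "'a measure \<Rightarrow> real set \<Rightarrow> (real \<Rightarrow> 'a \<Rightarrow> real) \<Rightarrow> bool" where
  "standing_assms M I X \<longleftrightarrow>
     (\<forall>t\<in>I. (\<forall>n::nat. integrable M (\<lambda>\<omega>. X t \<omega> ^ n)) \<and>
            infinite (msupp (law M X t)) \<and> moment_determinate (law M X t))"

definition poly_cond_moments :: "'a measure \<Rightarrow> real set \<Rightarrow> (real \<Rightarrow> 'a \<Rightarrow> real) \<Rightarrow> bool" where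
  "poly_cond_moments M I X \<longleftrightarrow>
     (\<forall>n::nat. \<forall>s\<in>I. \<forall>t\<in>I. s \<le> t \<longrightarrow>
        (\<exists>q::real poly. degree q \<le> n \<and>
           (AE \<omega> in M. real_cond_exp M (past_algebra M I X s) (\<lambda>\<omega>. X t \<omega> ^ n) \<omega> = poly q (X s \<omega>))))"

definition opm_polys ::
  "'a measure \<Rightarrow> real set \<Rightarrow> (real \<Rightarrow> 'a \<Rightarrow> real) \<Rightarrow> (nat \<Rightarrow> real \<Rightarrow> real poly) \<Rightarrow> (nat \<Rightarrow> real \<Rightarrow> real) \<Rightarrow> bool" where
  "opm_polys M I X p phat \<longleftrightarrow>
     (\<forall>t\<in>I. p 0 t = 1 \<and> (\<forall>n. degree (p n t) = n) \<and>
        (\<forall>n m. (\<integral>\<omega>. poly (p n t) (X t \<omega>) * poly (p m t) (X t \<omega>) \<partial>M)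
                 = (if n = m then phat n t else 0))) \<and>
     (\<forall>n. \<forall>s\<in>I. \<forall>t\<in>I. s \<le> t \<longrightarrow>
        (AE \<omega> in M. real_cond_exp M (past_algebra M I X s) (\<lambda>\<omega>. poly (p n t) (X t \<omega>)) \<omega>
                     = poly (p n s) (X s \<omega>)))"

end

theory Submission
  imports
    Defs
    "HOL-Computational_Algebra.Fundamental_Theorem_Algebra"
    "HOL-Real_Asymp.Real_Asymp"
begin

text \<open>
  For almost every \<open>y\<close> in the support of the law of \<open>X\<^sub>s\<close>, the martingale property identifies
  \<open>p\<^sub>n(y; s)\<close> with \<open>\<integral> p\<^sub>n(x; t) \<eta>(dx) = \<integral> \<phi> p\<^sub>n d\<mu>\<^sub>t\<close>, so the series is the Fourier expansion of \<open>\<phi>\<close> in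
  the orthogonal system \<open>p\<^sub>n(\<sqdot>; t)\<close>; Bessel's inequality gives summability. The convergence to \<open>\<phi>\<close> is
  Riesz's theorem that polynomials are dense in \<open>L\<^sub>2(\<mu>)\<close> when \<open>\<mu>\<close> is determined by its moments. If
  \<open>P\<close> ranges over the real polynomials with \<open>\<bar>P(\<i>)\<bar> = 1\<close>, determinacy forces
  \<open>inf \<integral> P\<^sup>2 / (1 + x\<^sup>2) d\<mu> = 0\<close>, since otherwise Hamburger's theorem yields a second measure with
  the same moments. Hence \<open>1 / (1 + x\<^sup>2)\<close> and \<open>x / (1 + x\<^sup>2)\<close> lie in the closure of the polynomials,
  which is then stable under multiplication by both, and Stone--Weierstrass on the circle
  parametrized by these two functions exhausts \<open>L\<^sub>2(\<mu>)\<close>.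
\<close>

section \<open>Gauss quadrature\<close>

text \<open>Polynomials are unbounded, so Weierstrass approximation says nothing directly about
  their density in an \<open>L\<^sub>2\<close> space over the line; the point \<open>\<i>\<close>
  off the real axis and the weight \<open>1 / (1 + x\<^sup>2)\<close> supply bounded multipliers
  instead. The second solution of the moment problem must be a measure, not just a functional: it
  comes from a weak limit of the finitely supported measures of Gauss quadrature, and truncation is
  needed because powers are not bounded test functions. The kernel is tied to the process only
  through conditional expectations of indicators, hence up to null sets; the identity for
  \<open>p\<^sub>n\<close> is reached from indicators by measure equality, and each n brings its own
  exceptional set. This is why the expansion is claimed for almost every y.\<close>

definition cpoly :: "real poly \<Rightarrow> complex \<Rightarrow> complex" where
  "cpoly P z = poly (map_poly complex_of_real P) z"

lemma cpoly_0 [simp]: "cpoly 0 z = 0"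
  by (simp add: cpoly_def)

lemma cpoly_pCons [simp]: "cpoly (pCons a P) z = complex_of_real a + z * cpoly P z"
  by (simp add: cpoly_def map_poly_pCons)

lemma cpoly_add: "cpoly (P + Q) z = cpoly P z + cpoly Q z"
  by (induction P Q rule: poly_induct2) (auto simp: algebra_simps)

lemma cpoly_smult: "cpoly (smult c P) z = complex_of_real c * cpoly P z"
  by (induction P) (auto simp: algebra_simps)

lemma cpoly_mult: "cpoly (P * Q) z = cpoly P z * cpoly Q z"
  by (induction P) (auto simp: cpoly_add cpoly_smult algebra_simps)

lemma cpoly_of_real: "cpoly P (complex_of_real x) = complex_of_real (poly P x)"
  by (induction P) auto

text \<open>The quadratic \<open>(x - b)\<^sup>2 + c\<^sup>2\<close> covers two obstructions at
  once: a pair of conjugate roots for \<open>c \<noteq> 0\<close> and a double real root for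
  \<open>c = 0\<close>. Without either, every complex root is real and simple, so linear factors can
  be split off one by one.\<close>

lemma card_roots_eq_degree:
  fixes q :: "real poly"
  assumes "q \<noteq> 0" and "\<And>b c. \<not> [:b\<^sup>2 + c\<^sup>2, - 2 * b, 1:] dvd q"
  shows "card {x. poly q x = 0} = degree q"
  using assms
proof (induction "degree q" arbitrary: q)
  case 0
  then obtain a where a: "q = [:a:]"
    by (metis degree_eq_zeroE)
  with 0 have "{x. poly q x = 0} = {}" by auto
  with 0 show ?case by simp
next
  case (Suc n)
  define cq where "cq = map_poly complex_of_real q"
  have "degree cq = Suc n"
    unfolding cq_def using Suc.hyps(2) by (simp add: degree_map_poly)
  then obtain z where z: "poly cq z = 0"
    using fundamental_theorem_of_algebra_alt[of cq]
    by (metis constant_degree fundamental_theorem_of_algebra nat.distinct(1))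
  have z: "cpoly q z = 0"
    using z by (simp add: cq_def cpoly_def)
  \<comment> \<open>Modulo the real quadratic with roots z and its conjugate, q leaves a real
    remainder of degree at most 1. Vanishing at a non-real z, it would be zero, so the excluded
    quadratic would divide q.\<close>
  have "Im z = 0"
  proof (rule ccontr)
    assume im: "Im z \<noteq> 0"
    define d where "d = [:(Re z)\<^sup>2 + (Im z)\<^sup>2, - 2 * Re z, 1:]"
    define r where "r = q mod d"
    have d0: "d \<noteq> 0" and dd: "degree d = 2" by (simp_all add: d_def)
    have qd: "q = d * (q div d) + r" by (simp add: r_def)
    have "degree r < 2"
      using degree_mod_less[OF d0, of q] dd by (auto simp: r_def)
    then have r: "r = [:coeff r 0, coeff r 1:]"
      by (intro poly_eqI) (auto simp: coeff_pCons coeff_eq_0 split: nat.splits)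
    have dz: "cpoly d z = 0"
      by (simp add: d_def complex_eq_iff power2_eq_square algebra_simps)
    have "cpoly q z = cpoly d z * cpoly (q div d) z + cpoly r z"
      by (subst qd) (simp only: cpoly_add cpoly_mult)
    then have "cpoly r z = 0"
      using z dz by simp
    then have "complex_of_real (coeff r 0) + z * complex_of_real (coeff r 1) = 0"
      by (subst (asm) r) simp
    then have "coeff r 1 = 0" "coeff r 0 = 0"
      using im by (auto simp: complex_eq_iff)
    with r have "r = 0" by simp
    then show False using Suc.prems(2)[of "Re z" "Im z"] qd
      by (metis add.right_neutral d_def dvd_triv_left)
  qed
  then obtain a where a: "z = complex_of_real a"
    by (metis complex_is_Real_iff of_real_Re)
  have "poly q a = 0"
    using z by (simp add: a cpoly_of_real)
  then obtain h where h: "q = [:-a, 1:] * h"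
    by (auto simp: poly_eq_0_iff_dvd elim: dvdE)
  have h0: "h \<noteq> 0" using h Suc.prems by auto
  have dh: "degree h = n" using Suc.hyps(2) h0 unfolding h
    by (subst (asm) degree_mult_eq) auto
  have ih: "card {x. poly h x = 0} = degree h"
  proof (rule Suc.hyps(1))
    show "\<not> [:b\<^sup>2 + c\<^sup>2, - 2 * b, 1:] dvd h" for b c
      using Suc.prems(2)[of b c] h dvd_mult by metis
  qed (use dh h0 in auto)
  have "poly h a \<noteq> 0"
  proof
    assume "poly h a = 0"
    then obtain k where "h = [:-a, 1:] * k" by (auto simp: poly_eq_0_iff_dvd elim: dvdE)
    \<comment> \<open>A double root at a is the case \<open>b = a\<close>, \<open>c = 0\<close> of
      the excluded divisor.\<close>
    then have "q = [:a\<^sup>2 + 0\<^sup>2, - 2 * a, 1:] * k"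
    proof -
      have "[:a\<^sup>2 + 0\<^sup>2, - 2 * a, 1:] = [:-a, 1:] * [:-a, 1:]"
        by (simp add: power2_eq_square)
      then show ?thesis
        unfolding h \<open>h = [:-a, 1:] * k\<close> by (simp only: mult.assoc)
    qed
    then show False using Suc.prems(2)[of a 0] by (metis dvd_triv_left)
  qed
  moreover have "{x. poly q x = 0} = insert a {x. poly h x = 0}"
    using h by auto
  ultimately show ?case
    using ih dh Suc.hyps(2) poly_roots_finite[OF h0] by simp
qed

text \<open>Linearity and strict positivity on squares make \<open>L (P * Q)\<close> an inner
  product on polynomials, which is what Gram-Schmidt and quadrature rest on.\<close>

locale positive_functional =
  fixes L :: "real poly \<Rightarrow> real"
  assumes add: "L (P + Q) = L P + L Q"
    and smult: "L (smult c P) = c * L P"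
    and pos: "P \<noteq> 0 \<Longrightarrow> L (P * P) > 0"
begin

lemma zero [simp]: "L 0 = 0"
  using smult[of 0 0] by simp

lemma uminus: "L (- P) = - L P"
  using smult[of "-1" P] by simp

lemma diff: "L (P - Q) = L P - L Q"
  using add[of P "- Q"] uminus[of Q] by simp

lemma sum: "L (\<Sum>i\<in>A. f i) = (\<Sum>i\<in>A. L (f i))"
  by (induction A rule: infinite_finite_induct) (auto simp: add)

text \<open>Gram-Schmidt, phrased as orthogonal projection onto the polynomials of degree below m.
  The subspace is described by vanishing coefficients because \<open>degree h < m\<close> would
  exclude even the zero polynomial when \<open>m = 0\<close>.\<close>

lemma exists_projection:
  "\<exists>r. (\<forall>k\<ge>m. coeff r k = 0) \<and> (\<forall>h. (\<forall>k\<ge>m. coeff h k = 0) \<longrightarrow> L ((P - r) * h) = 0)"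
proof (induction m arbitrary: P)
  case 0
  have "L (P * h) = 0" if "\<forall>k. coeff h k = 0" for h
    using that poly_eqI[of h 0] by simp
  then show ?case by (intro exI[of _ 0]) auto
next
  case (Suc m)
  obtain s where s: "\<forall>k\<ge>m. coeff s k = 0"
    "\<And>h. \<forall>k\<ge>m. coeff h k = 0 \<Longrightarrow> L ((monom 1 m - s) * h) = 0"
    using Suc.IH by metis
  obtain r where r: "\<forall>k\<ge>m. coeff r k = 0"
    "\<And>h. \<forall>k\<ge>m. coeff h k = 0 \<Longrightarrow> L ((P - r) * h) = 0"
    using Suc.IH by metis
  \<comment> \<open>e is the monic orthogonal polynomial of degree m; with c the Fourier coefficient
    of P along it, \<open>smult c e\<close> corrects the projection r to the next dimension.\<close>
  define e where "e = monom 1 m - s"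
  have ek: "coeff e k = 0" if "k \<ge> Suc m" for k
    using s(1) that by (auto simp: e_def)
  have em: "coeff e m = 1" using s(1) by (simp add: e_def)
  then have ee: "L (e * e) > 0" by (intro pos) auto
  define c where "c = L ((P - r) * e) / L (e * e)"
  show ?case
  proof (intro exI[of _ "r + smult c e"] conjI allI impI)
    show "coeff (r + smult c e) k = 0" if "k \<ge> Suc m" for k
      using that r(1) ek by simp
    fix h :: "real poly" assume h: "\<forall>k\<ge>Suc m. coeff h k = 0"
    define h' where "h' = h - smult (coeff h m) e"
    have h': "\<forall>k\<ge>m. coeff h' k = 0"
    proof (intro allI impI)
      fix k assume "k \<ge> m"
      then show "coeff h' k = 0"
        using h ek em by (cases "k = m") (auto simp: h'_def)
    qed
    have eh': "L (e * h') = 0" using s(2)[OF h'] by (simp add: e_def)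
    have rh': "L ((P - r) * h') = 0" by (rule r(2)[OF h'])
    have "(P - (r + smult c e)) * h = (P - r) * h' + smult (coeff h m) ((P - r) * e)
        - smult c (e * h') - smult (c * coeff h m) (e * e)"
      by (simp add: h'_def algebra_simps smult_diff_right smult_add_right)
    then have "L ((P - (r + smult c e)) * h)
        = coeff h m * L ((P - r) * e) - c * coeff h m * L (e * e)"
      by (simp add: add diff smult eh' rh')
    also have "\<dots> = 0" using ee by (simp add: c_def)
    finally show "L ((P - (r + smult c e)) * h) = 0" .
  qed
qed

lemma exists_orthogonal:
  assumes "n > 0"
  shows "\<exists>q. degree q = n \<and> (\<forall>h. degree h < n \<longrightarrow> L (q * h) = 0)"
proof -
  obtain r where r: "\<forall>k\<ge>n. coeff r k = 0"
    "\<And>h. \<forall>k\<ge>n. coeff h k = 0 \<Longrightarrow> L ((monom 1 n - r) * h) = 0"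
    using exists_projection by metis
  have "degree (monom 1 n - r) = n"
    using r(1) by (intro antisym degree_le le_degree) auto
  moreover have "L ((monom 1 n - r) * h) = 0" if "degree h < n" for h
    using that by (intro r(2)) (auto simp: coeff_eq_0)
  ultimately show ?thesis by blast
qed

text \<open>The nodes are the roots of the orthogonal polynomial q of degree n. Interpolation is
  exact below degree n; division by q doubles the range, since the quotient has degree below n and
  is orthogonal to q, while q vanishes at the nodes. Each weight is the value of L at the square of
  a Lagrange polynomial, hence nonnegative.\<close>

theorem gauss_quadrature:
  assumes n: "n > 0"
  shows "\<exists>R w. finite R \<and> (\<forall>x\<in>R. w x \<ge> 0) \<and>
           (\<forall>P. degree P < 2 * n \<longrightarrow> L P = (\<Sum>x\<in>R. w x * poly P x))"
proof -
  obtain q where q: "degree q = n" and orth: "\<And>h. degree h < n \<Longrightarrow> L (q * h) = 0"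
    using exists_orthogonal[OF n] by blast
  have q0: "q \<noteq> 0" using q n by auto
  define R where "R = {x. poly q x = 0}"
  have finR: "finite R" unfolding R_def by (rule poly_roots_finite[OF q0])
  have cardR: "card R = n" unfolding R_def q[symmetric]
  proof (rule card_roots_eq_degree[OF q0], rule notI)
    \<comment> \<open>With h the cofactor, \<open>q * h\<close> is
      \<open>((x - b) * h)\<^sup>2 + (c * h)\<^sup>2\<close>, on which L is positive, whereas
      \<open>degree h < n\<close> makes \<open>L (q * h)\<close> zero by orthogonality.\<close>
    fix b c assume "[:b\<^sup>2 + c\<^sup>2, - 2 * b, 1:] dvd q"
    then obtain h where h: "q = [:b\<^sup>2 + c\<^sup>2, - 2 * b, 1:] * h" by (elim dvdE)
    have h0: "h \<noteq> 0" using h q0 by auto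
    have "degree q = 2 + degree h" by (subst h, subst degree_mult_eq) (use h0 in auto)
    then have "L (q * h) = 0" using q by (intro orth) simp
    moreover have "q * h = ([:-b, 1:] * h) * ([:-b, 1:] * h) + smult (c\<^sup>2) (h * h)"
    proof -
      have "[:b\<^sup>2 + c\<^sup>2, - 2 * b, 1:] = [:-b, 1:] * [:-b, 1:] + [:c\<^sup>2:]"
        by (simp add: power2_eq_square)
      then have "q * h = ([:-b, 1:] * [:-b, 1:] + [:c\<^sup>2:]) * h * h" using h by simp
      also have "\<dots> = ([:-b, 1:] * h) * ([:-b, 1:] * h) + [:c\<^sup>2:] * (h * h)"
        by (simp only: distrib_right distrib_left mult_ac)
      finally show ?thesis by simp
    qed
    moreover have "L (([:-b, 1:] * h) * ([:-b, 1:] * h)) > 0"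
      using h0 by (intro pos) (simp del: mult_pCons_left)
    moreover have "L (smult (c\<^sup>2) (h * h)) \<ge> 0"
      using pos[OF h0] by (simp add: smult)
    ultimately show False by (simp add: add)
  qed
  define l where "l x = smult (inverse (\<Prod>y\<in>R-{x}. x - y)) (\<Prod>y\<in>R-{x}. [:-y, 1:])" for x
  have l: "poly (l x) y = (if y = x then 1 else 0)" if "x \<in> R" "y \<in> R" for x y
    using that finR by (auto simp: l_def poly_prod)
  have dl: "degree (l x) < n" if "x \<in> R" for x
  proof -
    have "degree (\<Prod>y\<in>R-{x}. [:-y, 1:]) = (\<Sum>y\<in>R-{x}. 1)"
      by (subst degree_prod_eq_sum_degree) auto
    then show ?thesis using that finR cardR n by (auto simp: l_def)
  qed
  define w where "w x = L (l x)" for x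
  have interp: "L P = (\<Sum>x\<in>R. w x * poly P x)" if "degree P < n" for P
  proof -
    have "P = (\<Sum>x\<in>R. smult (poly P x) (l x))"
    proof (rule poly_eqI_degree[of R])
      show "poly P x = poly (\<Sum>x\<in>R. smult (poly P x) (l x)) x" if "x \<in> R" for x
      proof -
        have "poly (\<Sum>x\<in>R. smult (poly P x) (l x)) x
            = (\<Sum>y\<in>R. poly P y * (if x = y then 1 else 0))"
          unfolding poly_sum poly_smult using that by (intro sum.cong) (auto simp: l)
        also have "\<dots> = poly P x" using that finR by (simp add: sum.delta' if_distrib cong: if_cong)
        finally show ?thesis by simp
      qed
      show "card R > degree P" using cardR that by simp
      have "degree (\<Sum>x\<in>R. smult (poly P x) (l x)) \<le> n - 1"
        using dl n by (intro degree_sum_le)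
          (auto simp: finR less_Suc_eq_le[symmetric] intro!: order.trans[OF degree_smult_le])
      then show "card R > degree (\<Sum>x\<in>R. smult (poly P x) (l x))" using cardR n by simp
    qed
    then have "L P = L (\<Sum>x\<in>R. smult (poly P x) (l x))" by simp
    also have "\<dots> = (\<Sum>x\<in>R. w x * poly P x)"
      by (simp add: sum smult w_def mult.commute)
    finally show ?thesis .
  qed
  have exact: "L P = (\<Sum>x\<in>R. w x * poly P x)" if P: "degree P < 2 * n" for P
  proof -
    have P': "P = q * (P div q) + P mod q" by simp
    have dm: "degree (P mod q) < n" using degree_mod_less'[of q P] q0 q n by (cases "P mod q = 0") auto
    have "degree (P div q) < n"
    proof (cases "P div q = 0")
      case False
      then have "degree (q * (P div q)) = n + degree (P div q)"
        using q q0 by (simp add: degree_mult_eq)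
      moreover have "degree P = degree (q * (P div q))"
        by (subst P', rule degree_add_eq_left) (use calculation dm in simp)
      ultimately show ?thesis using P by simp
    qed (use n in simp)
    then have "L (q * (P div q)) = 0" by (rule orth)
    then have "L P = L (P mod q)" by (metis P' add add_0)
    also have "\<dots> = (\<Sum>x\<in>R. w x * poly (P mod q) x)" by (rule interp[OF dm])
    also have "\<dots> = (\<Sum>x\<in>R. w x * poly P x)"
    proof (intro sum.cong refl)
      fix x assume "x \<in> R"
      then have "poly P x = poly (P mod q) x"
        using arg_cong[OF P', of "\<lambda>p. poly p x"] by (simp only: poly_add poly_mult) (simp add: R_def)
      then show "w x * poly (P mod q) x = w x * poly P x" by simp
    qed
    finally show ?thesis .
  qed
  have wpos: "w x \<ge> 0" if x: "x \<in> R" for x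
  proof -
    have "degree (l x * l x) < 2 * n"
      using dl[OF x] degree_mult_le[of "l x" "l x"] by linarith
    then have "L (l x * l x) = (\<Sum>y\<in>R. w y * (if y = x then 1 else 0))"
      using exact[of "l x * l x"] x by (auto simp: l intro!: sum.cong)
    also have "\<dots> = w x" using x finR by (simp add: sum.delta if_distrib cong: if_cong)
    finally have "w x = L (l x * l x)" by simp
    moreover have "l x \<noteq> 0" using l[OF x x] by auto
    ultimately show ?thesis using pos[of "l x"] by simp
  qed
  show ?thesis
    using finR wpos exact by (intro exI[of _ R] exI[of _ w]) auto
qed

end

section \<open>Hamburger's theorem\<close>

text \<open>Powers of the truncated variable are bounded and continuous, hence admissible test
  functions for weak convergence, unlike the powers of x.\<close>

definition clip :: "real \<Rightarrow> real \<Rightarrow> real" where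
  "clip A x = max (- A) (min A x)"

lemma clip_measurable [measurable]: "clip A \<in> borel_measurable borel"
  unfolding clip_def by measurable

lemma isCont_clip_power: "isCont (\<lambda>x. clip A x ^ k) x"
  unfolding clip_def by (intro continuous_intros)

lemma abs_clip_le: "A \<ge> 0 \<Longrightarrow> \<bar>clip A x\<bar> \<le> A" "A \<ge> 0 \<Longrightarrow> \<bar>clip A x\<bar> \<le> \<bar>x\<bar>"
  by (auto simp: clip_def)

lemma clip_power_bound: "A \<ge> 0 \<Longrightarrow> \<bar>clip A x ^ k\<bar> \<le> A ^ k"
  unfolding power_abs by (intro power_mono abs_clip_le) auto

text \<open>Only \<open>\<bar>x\<bar> > A \<ge> 1\<close> contributes; there raising the exponent
  only enlarges the bound, and one further factor \<open>\<bar>x\<bar>\<close> pays for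
  \<open>1 / A\<close>. The exponent \<open>2 * k + 2\<close> is even, so the bound is a plain
  moment, without absolute values.\<close>

lemma clip_power_diff_le:
  assumes "A \<ge> 1"
  shows "\<bar>x ^ k - clip A x ^ k\<bar> \<le> 2 / A * x ^ (2 * k + 2)"
proof (cases "\<bar>x\<bar> \<le> A")
  case True
  then have "clip A x = x" by (auto simp: clip_def)
  moreover have "x ^ (2 * k + 2) \<ge> 0" by (rule zero_le_even_power) simp
  ultimately show ?thesis using assms by simp
next
  case False
  have "\<bar>clip A x ^ k\<bar> \<le> \<bar>x\<bar> ^ k"
    unfolding power_abs using assms by (intro power_mono abs_clip_le) auto
  then have "\<bar>x ^ k - clip A x ^ k\<bar> \<le> 2 * \<bar>x\<bar> ^ k"
    using abs_triangle_ineq4[of "x ^ k" "clip A x ^ k"] by (simp add: power_abs)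
  also have "\<dots> \<le> 2 * \<bar>x\<bar> ^ (2 * k + 1)"
    using False assms by (intro mult_left_mono power_increasing) auto
  also have "\<dots> \<le> 2 / A * \<bar>x\<bar> ^ (2 * k + 2)"
  proof -
    have "A * \<bar>x\<bar> ^ (2 * k + 1) \<le> \<bar>x\<bar> * \<bar>x\<bar> ^ (2 * k + 1)"
      using False by (intro mult_right_mono) auto
    then show ?thesis using assms by (simp add: field_simps)
  qed
  also have "\<bar>x\<bar> ^ (2 * k + 2) = x ^ (2 * k + 2)"
    by (rule power_even_abs) auto
  finally show ?thesis .
qed

lemma clip_tendsto: "(\<lambda>n. clip (real n) x ^ k) \<longlonglongrightarrow> x ^ k"
proof (rule tendsto_eventually)
  show "\<forall>\<^sub>F n in sequentially. clip (real n) x ^ k = x ^ k"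
    using eventually_ge_at_top[of "nat \<lceil>\<bar>x\<bar>\<rceil>"]
    by eventually_elim (auto simp: clip_def nat_le_iff ceiling_le_iff)
qed

text \<open>Fatou's lemma will yield only even moments of a weak limit;
  \<open>2 * \<bar>a\<bar> \<le> 1 + a\<^sup>2\<close> and finite mass pass from these to all
  powers.\<close>

lemma (in prob_space) integrable_power_le_even:
  assumes "integrable M (\<lambda>x. f x ^ (2 * k))" and [measurable]: "f \<in> borel_measurable M"
  shows "integrable M (\<lambda>x. (f x :: real) ^ k)"
proof (rule Bochner_Integration.integrable_bound)
  show "integrable M (\<lambda>x. 1 + f x ^ (2 * k))" using assms by auto
  show "AE x in M. norm (f x ^ k) \<le> norm (1 + f x ^ (2 * k))"
  proof (rule AE_I2)
    fix x
    have "0 \<le> (\<bar>f x ^ k\<bar> - 1)\<^sup>2" by simp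
    then have "2 * \<bar>f x ^ k\<bar> \<le> 1 + (f x ^ k)\<^sup>2"
      by (simp add: power2_eq_square algebra_simps)
    then show "norm (f x ^ k) \<le> norm (1 + f x ^ (2 * k))"
      by (simp add: power_mult[symmetric] mult.commute)
  qed
qed auto

lemma (in real_distribution) integral_clip_power_diff_le:
  assumes "\<And>j. integrable M (\<lambda>x::real. x ^ j)" "A \<ge> 1"
  shows "\<bar>(\<integral>x. x ^ k \<partial>M) - (\<integral>x. clip A x ^ k \<partial>M)\<bar> \<le> 2 / A * (\<integral>x. x ^ (2 * k + 2) \<partial>M)"
proof -
  have i1: "integrable M (\<lambda>x. x ^ k)" by (rule assms(1))
  have i2: "integrable M (\<lambda>x. clip A x ^ k)"
    using assms(2) by (intro integrable_const_bound[of _ "A ^ k"]) (auto intro!: clip_power_bound AE_I2)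
  have "\<bar>(\<integral>x. x ^ k \<partial>M) - (\<integral>x. clip A x ^ k \<partial>M)\<bar> = \<bar>\<integral>x. x ^ k - clip A x ^ k \<partial>M\<bar>"
    using i1 i2 by simp
  also have "\<dots> \<le> (\<integral>x. \<bar>x ^ k - clip A x ^ k\<bar> \<partial>M)" by (rule integral_abs_bound)
  also have "\<dots> \<le> (\<integral>x. 2 / A * x ^ (2 * k + 2) \<partial>M)"
    using i1 i2 assms(2)
    by (intro integral_mono clip_power_diff_le integrable_abs Bochner_Integration.integrable_diff
        integrable_mult_right assms(1))
  also have "\<dots> = 2 / A * (\<integral>x. x ^ (2 * k + 2) \<partial>M)" by simp
  finally show ?thesis .
qed

text \<open>Chebyshev's inequality, for the half-open intervals in which \<open>tight\<close> is
  phrased.\<close>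

lemma (in real_distribution) measure_interval_ge:
  assumes "integrable M (\<lambda>x. x\<^sup>2)" "a > 0"
  shows "1 - (\<integral>x. x\<^sup>2 \<partial>M) / a\<^sup>2 \<le> measure M {-a<..a}"
proof -
  have ind: "integrable M (indicator {-a<..a} :: real \<Rightarrow> real)"
    by (intro integrable_const_bound[of _ 1]) auto
  have "(\<integral>x. 1 - x\<^sup>2 / a\<^sup>2 \<partial>M) \<le> (\<integral>x. indicator {-a<..a} x \<partial>M)"
  proof (rule integral_mono)
    fix x
    show "1 - x\<^sup>2 / a\<^sup>2 \<le> indicator {-a<..a} x"
    proof (cases "x \<in> {-a<..a}")
      case False
      then have "a\<^sup>2 \<le> x\<^sup>2" using assms(2) by (intro abs_le_square_iff[THEN iffD1]) auto
      then show ?thesis using False assms(2) by (simp add: field_simps)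
    qed auto
  qed (use assms(1) ind in auto)
  then show ?thesis using assms(1) prob_space by simp
qed

context positive_functional
begin

lemma monom_even_nonneg: "L (monom 1 (2 * k)) > 0"
proof -
  have "L (monom 1 k * monom 1 k) > 0" by (rule pos) simp
  then show ?thesis by (simp add: mult_monom mult_2)
qed

text \<open>Quadrature with \<open>n + 1\<close> nodes, read as a discrete measure: the weights are
  nonnegative and sum to \<open>L 1\<close>, and the formula is exact up to degree
  \<open>2 * n + 1\<close>.\<close>

lemma exists_truncated_representation:
  assumes L1: "L 1 = 1"
  shows "\<exists>\<nu>. real_distribution \<nu> \<and> (\<forall>k. integrable \<nu> (\<lambda>x. x ^ k)) \<and>
           (\<forall>k<n. (\<integral>x. x ^ k \<partial>\<nu>) = L (monom 1 k))"
proof -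
  obtain R w where R: "finite R" and w: "\<And>x. x \<in> R \<Longrightarrow> w x \<ge> 0"
    and q: "\<And>P. degree P < 2 * (n + 1) \<Longrightarrow> L P = (\<Sum>x\<in>R. w x * poly P x)"
    using gauss_quadrature[of "n + 1"] by auto
  have sum1: "(\<Sum>x\<in>R. w x) = 1" using q[of 1] L1 by simp
  interpret prob_space "point_measure R w"
  proof
    have "emeasure (point_measure R w) R = (\<Sum>x\<in>R. ennreal (w x))"
      using R by (intro emeasure_point_measure_finite) auto
    also have "\<dots> = 1" using w sum1 by (simp add: sum_ennreal)
    finally show "emeasure (point_measure R w) (space (point_measure R w)) = 1"
      by (simp add: space_point_measure)
  qed
  have m: "(\<lambda>x. x) \<in> measurable (point_measure R w) borel" by simp
  show ?thesis
  proof (intro exI[of _ "distr (point_measure R w) borel (\<lambda>x. x)"] conjI allI impI)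
    show "real_distribution (distr (point_measure R w) borel (\<lambda>x. x))"
      by (rule real_distribution_distr[OF m])
    show "integrable (distr (point_measure R w) borel (\<lambda>x. x)) (\<lambda>x. x ^ k)" for k
      by (subst integrable_distr_eq[OF m]) (auto intro!: integrable_point_measure_finite R)
    show "(\<integral>x. x ^ k \<partial>distr (point_measure R w) borel (\<lambda>x. x)) = L (monom 1 k)" if "k < n" for k
      using that w R q[of "monom 1 k"]
      by (subst integral_distr[OF m])
         (auto simp: lebesgue_integral_point_measure_finite poly_monom degree_monom_eq)
  qed
qed

text \<open>All second moments of the truncated representations agree, so these measures are tight
  and have a weak limit. Powers being unbounded, convergence of moments needs an error bound uniform
  in the index: the variable is truncated at the cost of a higher moment.\<close>

theorem hamburger:
  assumes L1: "L 1 = 1"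
  shows "\<exists>\<nu>. real_distribution \<nu> \<and> (\<forall>k. integrable \<nu> (\<lambda>x. x ^ k)) \<and>
           (\<forall>P. (\<integral>x. poly P x \<partial>\<nu>) = L P)"
proof -
  \<comment> \<open>The offset 3 makes the second moment correct for every index, including 0;
    tightness uses it.\<close>
  have "\<exists>\<nu>. \<forall>n. real_distribution (\<nu> n) \<and> (\<forall>k. integrable (\<nu> n) (\<lambda>x. x ^ k)) \<and>
           (\<forall>k<n+3. (\<integral>x. x ^ k \<partial>\<nu> n) = L (monom 1 k))"
    by (intro choice allI exists_truncated_representation L1)
  then obtain \<nu>s where \<nu>s: "\<And>n. real_distribution (\<nu>s n)"
    and int: "\<And>n k. integrable (\<nu>s n) (\<lambda>x. x ^ k)"
    and mom: "\<And>n k. k < n + 3 \<Longrightarrow> (\<integral>x. x ^ k \<partial>\<nu>s n) = L (monom 1 k)" by blast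
  define C where "C = L (monom 1 2)"
  have tight: "tight \<nu>s" unfolding tight_def
  proof (intro conjI allI impI)
    show "real_distribution (\<nu>s n)" for n by fact
    fix \<epsilon> :: real assume e: "\<epsilon> > 0"
    \<comment> \<open>\<open>a \<ge> 1\<close> gives \<open>a \<le> a\<^sup>2\<close>, and
      \<open>C / \<epsilon> < a\<close> then makes \<open>C / a\<^sup>2\<close> smaller than
      \<open>\<epsilon>\<close>.\<close>
    define a where "a = max 1 (C / \<epsilon> + 1)"
    have a: "a \<ge> 1" "C / \<epsilon> < a" by (auto simp: a_def)
    have C: "C > 0" using monom_even_nonneg[of 1] by (simp add: C_def)
    have "C / a\<^sup>2 \<le> C / a" using a C by (intro divide_left_mono) (auto simp: power2_eq_square)
    also have "\<dots> < \<epsilon>" using a e by (simp add: field_simps)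
    finally have "C / a\<^sup>2 < \<epsilon>" .
    moreover have "1 - C / a\<^sup>2 \<le> measure (\<nu>s n) {-a<..a}" for n
      using real_distribution.measure_interval_ge[OF \<nu>s int, of a n] mom[of 2 n] a by (simp add: C_def)
    ultimately have "\<forall>n. 1 - \<epsilon> < measure (\<nu>s n) {-a<..a}"
      by (smt (verit))
    with a show "\<exists>a b. a < b \<and> (\<forall>n. 1 - \<epsilon> < measure (\<nu>s n) {a<..b})"
      by (intro exI[of _ "-a"] exI[of _ a]) auto
  qed
  obtain r \<nu> where r: "strict_mono r" and \<nu>: "real_distribution \<nu>"
    and conv: "weak_conv_m (\<lambda>n. \<nu>s (r n)) \<nu>"
    using tight_imp_convergent_subsubsequence[OF tight, of id] by (auto simp: strict_mono_def o_def)
  interpret real_distribution \<nu> by fact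
  have lim: "(\<lambda>n. \<integral>x. clip A x ^ k \<partial>\<nu>s (r n)) \<longlonglongrightarrow> (\<integral>x. clip A x ^ k \<partial>\<nu>)" if "A \<ge> 0" for A k
    by (rule weak_conv_imp_integral_bdd_continuous_conv[OF \<nu>s \<nu> conv, where B = "A ^ k"])
       (auto intro: isCont_clip_power clip_power_bound that)
  have mom': "\<forall>\<^sub>F n in sequentially. (\<integral>x. x ^ k \<partial>\<nu>s (r n)) = L (monom 1 k)" for k
    using eventually_ge_at_top[of k]
  proof eventually_elim
    case (elim n)
    then show ?case using seq_suble[OF r, of n] by (intro mom) auto
  qed
  have ci: "integrable (\<nu>s n) (\<lambda>x. clip A x ^ k)" "integrable \<nu> (\<lambda>x. clip A x ^ k)"
    if "A \<ge> 0" for A k n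
  proof -
    interpret n: real_distribution "\<nu>s n" by fact
    show "integrable (\<nu>s n) (\<lambda>x. clip A x ^ k)"
      by (intro n.integrable_const_bound[of _ "A ^ k"]) (auto intro!: clip_power_bound AE_I2 that)
    show "integrable \<nu> (\<lambda>x. clip A x ^ k)"
      by (intro integrable_const_bound[of _ "A ^ k"]) (auto intro!: clip_power_bound AE_I2 that)
  qed
  \<comment> \<open>Truncation only decreases even powers, so the moments given by L bound the
    truncated integrals in the limit, and Fatou's lemma removes the truncation.\<close>
  have even: "integrable \<nu> (\<lambda>x. x ^ (2 * k))" for k
  proof (rule integrableI_nonneg)
    have le: "(\<integral>x. clip A x ^ (2 * k) \<partial>\<nu>) \<le> L (monom 1 (2 * k))" if "A \<ge> 0" for A
    proof (rule tendsto_upperbound[OF lim[OF that]])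
      show "\<forall>\<^sub>F n in sequentially. (\<integral>x. clip A x ^ (2 * k) \<partial>\<nu>s (r n)) \<le> L (monom 1 (2 * k))"
        using mom'[of "2 * k"]
      proof eventually_elim
        case (elim n)
        have "(\<integral>x. clip A x ^ (2 * k) \<partial>\<nu>s (r n)) \<le> (\<integral>x. x ^ (2 * k) \<partial>\<nu>s (r n))"
        proof (intro integral_mono ci int that)
          fix x
          have "\<bar>clip A x\<bar> ^ (2 * k) \<le> \<bar>x\<bar> ^ (2 * k)"
            by (intro power_mono abs_clip_le that) auto
          then show "clip A x ^ (2 * k) \<le> x ^ (2 * k)" by (simp add: power_even_abs)
        qed
        then show ?case using elim by simp
      qed
    qed simp
    have "(\<integral>\<^sup>+x. ennreal (x ^ (2 * k)) \<partial>\<nu>)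
        = (\<integral>\<^sup>+x. liminf (\<lambda>n. ennreal (clip (real n) x ^ (2 * k))) \<partial>\<nu>)"
      by (intro nn_integral_cong lim_imp_Liminf[symmetric] tendsto_ennrealI clip_tendsto) simp
    also have "\<dots> \<le> liminf (\<lambda>n. \<integral>\<^sup>+x. ennreal (clip (real n) x ^ (2 * k)) \<partial>\<nu>)"
      by (rule nn_integral_liminf) measurable
    also have "\<dots> \<le> ennreal (L (monom 1 (2 * k)))"
    proof (rule Liminf_le)
      show "\<forall>\<^sub>F n in sequentially. (\<integral>\<^sup>+x. ennreal (clip (real n) x ^ (2 * k)) \<partial>\<nu>)
          \<le> ennreal (L (monom 1 (2 * k)))"
        by (intro always_eventually allI, subst nn_integral_eq_integral)
           (auto intro!: ci ennreal_leI le)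
    qed simp
    finally show "(\<integral>\<^sup>+x. ennreal (x ^ (2 * k)) \<partial>\<nu>) < \<infinity>"
      by (auto simp: top_unique less_top[symmetric])
  qed auto
  have odd: "integrable \<nu> (\<lambda>x. x ^ k)" for k
    by (rule integrable_power_le_even[OF even]) simp
  have eq: "(\<integral>x. x ^ k \<partial>\<nu>) = L (monom 1 k)" for k
  proof -
    define D where "D = L (monom 1 (2 * k + 2)) + (\<integral>x. x ^ (2 * k + 2) \<partial>\<nu>)"
    \<comment> \<open>The truncation error is at most \<open>2 / A\<close> times a moment, both for
      the approximating measures with large index and for the limit. The index tends to infinity
      with A fixed, and A only afterwards.\<close>
    have bound: "\<bar>(\<integral>x. x ^ k \<partial>\<nu>) - L (monom 1 k)\<bar> \<le> 2 / A * D" if A: "A \<ge> 1" for A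
    proof -
      have "(\<lambda>n. \<bar>L (monom 1 k) - (\<integral>x. clip A x ^ k \<partial>\<nu>s (r n))\<bar>)
          \<longlonglongrightarrow> \<bar>L (monom 1 k) - (\<integral>x. clip A x ^ k \<partial>\<nu>)\<bar>"
        using A by (intro tendsto_intros lim) auto
      then have "\<bar>L (monom 1 k) - (\<integral>x. clip A x ^ k \<partial>\<nu>)\<bar> \<le> 2 / A * L (monom 1 (2 * k + 2))"
      proof (rule tendsto_upperbound)
        show "\<forall>\<^sub>F n in sequentially. \<bar>L (monom 1 k) - (\<integral>x. clip A x ^ k \<partial>\<nu>s (r n))\<bar>
            \<le> 2 / A * L (monom 1 (2 * k + 2))"
          using mom'[of k] mom'[of "2 * k + 2"]
        proof eventually_elim
          case (elim n)
          interpret n: real_distribution "\<nu>s (r n)" by fact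
          show ?case
            using n.integral_clip_power_diff_le[OF int A, of k] elim by simp
        qed
      qed simp
      moreover have "\<bar>(\<integral>x. x ^ k \<partial>\<nu>) - (\<integral>x. clip A x ^ k \<partial>\<nu>)\<bar> \<le> 2 / A * (\<integral>x. x ^ (2 * k + 2) \<partial>\<nu>)"
        by (rule integral_clip_power_diff_le[OF odd A])
      ultimately show ?thesis unfolding D_def distrib_left by linarith
    qed
    have "((\<lambda>A. 2 / A * D) \<longlongrightarrow> 0) at_top" by real_asymp
    then have "\<bar>(\<integral>x. x ^ k \<partial>\<nu>) - L (monom 1 k)\<bar> \<le> 0"
      by (rule tendsto_lowerbound)
         (use bound in \<open>auto simp: eventually_at_top_linorder\<close>)
    then show ?thesis by simp
  qed
  have "(\<integral>x. poly P x \<partial>\<nu>) = L P" for P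
  proof -
    have "L P = L (\<Sum>i\<le>degree P. smult (coeff P i) (monom 1 i))"
      by (simp add: smult_monom poly_as_sum_of_monoms)
    also have "\<dots> = (\<Sum>i\<le>degree P. coeff P i * (\<integral>x. x ^ i \<partial>\<nu>))"
      by (simp add: sum smult eq)
    also have "\<dots> = (\<integral>x. poly P x \<partial>\<nu>)"
      by (simp add: poly_altdef odd)
    finally show ?thesis by simp
  qed
  with \<nu> odd show ?thesis by blast
qed

end

section \<open>Density of polynomials under moment determinacy\<close>

text \<open>\<open>cay1\<close> and \<open>- cay2\<close> are the real and imaginary parts of
  \<open>1 / (1 + \<i> * x)\<close>, a variant of the Cayley transform. The point
  \<open>(cay1 x, cay2 x)\<close> runs over the circle with centre \<open>(1/2, 0)\<close> and
  radius \<open>1/2\<close>, without the origin, which corresponds to infinity.\<close>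

definition cay1 :: "real \<Rightarrow> real" where "cay1 x = 1 / (1 + x\<^sup>2)"
definition cay2 :: "real \<Rightarrow> real" where "cay2 x = x / (1 + x\<^sup>2)"

lemma cay_measurable [measurable]: "cay1 \<in> borel_measurable borel" "cay2 \<in> borel_measurable borel"
  unfolding cay1_def cay2_def by measurable

lemma one_plus_square_pos: "1 + x\<^sup>2 > (0::real)"
  by (simp add: add_pos_nonneg)

lemma abs_cay1_le: "\<bar>cay1 x\<bar> \<le> 1"
  using one_plus_square_pos[of x] by (simp add: cay1_def)

lemma abs_cay2_le: "\<bar>cay2 x\<bar> \<le> 1"
proof -
  have "0 \<le> (\<bar>x\<bar> - 1)\<^sup>2" by simp
  then have "\<bar>x\<bar> \<le> 1 + x\<^sup>2" using zero_le_power2[of x]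
    by (simp add: power2_eq_square algebra_simps)
  then show ?thesis using one_plus_square_pos[of x] by (simp add: cay2_def)
qed

lemma cay_circle: "(cay1 x)\<^sup>2 + (cay2 x)\<^sup>2 = cay1 x"
proof -
  have "(cay1 x)\<^sup>2 + (cay2 x)\<^sup>2 = (1 + x\<^sup>2) / (1 + x\<^sup>2)\<^sup>2"
    by (simp add: cay1_def cay2_def power_divide add_divide_distrib)
  also have "\<dots> = cay1 x" using one_plus_square_pos[of x] by (simp add: cay1_def power2_eq_square)
  finally show ?thesis .
qed

lemma cay1_mult: "(1 + x\<^sup>2) * cay1 x = 1"
  using one_plus_square_pos[of x] by (simp add: cay1_def)

lemma cay2_eq: "cay2 x = x * cay1 x"
  by (simp add: cay1_def cay2_def)

lemma x_cay2: "x * cay2 x = 1 - cay1 x"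
  using cay1_mult[of x] by (simp add: cay2_eq algebra_simps power2_eq_square)

definition cay :: "real \<Rightarrow> real \<times> real" where "cay x = (cay1 x, cay2 x)"

lemma inj_cay: "cay x = cay y \<Longrightarrow> x = y"
proof -
  assume "cay x = cay y"
  then have "cay1 x = cay1 y" "x * cay1 x = y * cay1 y" by (auto simp: cay_def cay2_eq)
  moreover have "cay1 y \<noteq> 0" using cay1_mult[of y] by auto
  ultimately show ?thesis by simp
qed

text \<open>The remainder modulo \<open>1 + x\<^sup>2\<close> is real of degree at most 1, so it is
  determined by its value at the root \<open>\<i>\<close>, where it agrees with P.\<close>

lemma poly_decompose:
  "\<exists>Q. \<forall>x. poly P x = (1 + x\<^sup>2) * poly Q x + Re (cpoly P \<i>) + Im (cpoly P \<i>) * x"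
proof -
  define d :: "real poly" where "d = [:1, 0, 1:]"
  define r where "r = P mod d"
  have d0: "d \<noteq> 0" and dd: "degree d = 2" by (simp_all add: d_def)
  have Pd: "P = d * (P div d) + r" by (simp add: r_def)
  have "degree r < 2"
    using degree_mod_less[OF d0, of P] dd by (auto simp: r_def)
  then have r: "r = [:coeff r 0, coeff r 1:]"
    by (intro poly_eqI) (auto simp: coeff_pCons coeff_eq_0 split: nat.splits)
  have "cpoly d \<i> = 0" by (simp add: d_def)
  then have "cpoly P \<i> = cpoly r \<i>"
    by (subst Pd) (simp only: cpoly_add cpoly_mult, simp)
  also have "\<dots> = complex_of_real (coeff r 0) + \<i> * complex_of_real (coeff r 1)"
    by (subst r) simp
  finally have E: "Re (cpoly P \<i>) = coeff r 0" "Im (cpoly P \<i>) = coeff r 1" by simp_all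
  have "poly P x = (1 + x\<^sup>2) * poly (P div d) x + Re (cpoly P \<i>) + Im (cpoly P \<i>) * x" for x
  proof -
    have "poly P x = poly d x * poly (P div d) x + poly r x"
      by (subst Pd) (simp only: poly_add poly_mult)
    also have "poly r x = coeff r 0 + coeff r 1 * x"
      by (subst r) simp
    also have "poly d x = 1 + x\<^sup>2" by (simp add: d_def power2_eq_square)
    finally show ?thesis by (simp add: E)
  qed
  then show ?thesis by blast
qed

text \<open>Multiplication by \<open>cay1\<close> or \<open>cay2\<close> leads out of the
  polynomials only by a combination of \<open>cay1\<close> and \<open>cay2\<close>. One Q serves
  both identities, as the second is x times the first, simplified by \<open>x_cay2\<close>.\<close>

lemma cay_mult_poly:
  "\<exists>Q. \<forall>x. cay1 x * poly P x = poly Q x + (Re (cpoly P \<i>) * cay1 x + Im (cpoly P \<i>) * cay2 x) \<and>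
           cay2 x * poly P x = x * poly Q x + (Re (cpoly P \<i>) * cay2 x + Im (cpoly P \<i>) * (1 - cay1 x))"
proof -
  define u v where "u = Re (cpoly P \<i>)" and "v = Im (cpoly P \<i>)"
  obtain Q where Q: "\<And>x. poly P x = (1 + x\<^sup>2) * poly Q x + u + v * x"
    using poly_decompose[of P] unfolding u_def v_def by blast
  have aP: "cay1 x * poly P x = poly Q x + (u * cay1 x + v * cay2 x)" for x
  proof -
    have "cay1 x * poly P x = ((1 + x\<^sup>2) * cay1 x) * poly Q x + (u * cay1 x + v * (x * cay1 x))"
      unfolding Q by (simp only: algebra_simps)
    then show ?thesis by (simp only: cay1_mult cay2_eq mult_1)
  qed
  have "cay2 x * poly P x = x * poly Q x + (u * cay2 x + v * (1 - cay1 x))" for x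
  proof -
    have "cay2 x * poly P x = x * (cay1 x * poly P x)" by (simp add: cay2_eq)
    also have "\<dots> = x * poly Q x + (u * (x * cay1 x) + v * (x * cay2 x))"
      unfolding aP by (simp add: algebra_simps)
    also have "\<dots> = x * poly Q x + (u * cay2 x + v * (1 - cay1 x))"
      unfolding x_cay2 by (simp add: cay2_eq)
    finally show ?thesis .
  qed
  with aP show ?thesis unfolding u_def v_def by blast
qed

text \<open>\<open>poly_square_pos\<close> says that no nonzero polynomial vanishes almost
  everywhere. It holds for laws of infinite support and makes the form given by the moments
  definite.\<close>

locale moment_distribution = real_distribution M for M +
  assumes integrable_power: "integrable M (\<lambda>x::real. x ^ k)"
    and poly_square_pos: "P \<noteq> 0 \<Longrightarrow> (\<integral>x. (poly P x)\<^sup>2 \<partial>M) > 0"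
begin

lemma integrable_poly: "integrable M (\<lambda>x. poly P x)"
  unfolding poly_altdef by (intro Bochner_Integration.integrable_sum integrable_mult_right integrable_power)

lemma borel_measurable_poly [measurable]: "(\<lambda>x::real. poly P x) \<in> borel_measurable borel"
  unfolding poly_altdef by measurable

lemma integrable_poly_power: "integrable M (\<lambda>x. poly P x ^ k)"
  using integrable_poly[of "P ^ k"] by simp

lemma integrable_poly_div: "integrable M (\<lambda>x. poly P x / (1 + x\<^sup>2))"
proof (rule Bochner_Integration.integrable_bound[OF integrable_poly[of P]])
  have "\<bar>poly P x\<bar> \<le> \<bar>poly P x\<bar> * (1 + x\<^sup>2)" for x
    by (simp add: algebra_simps)
  then show "AE x in M. norm (poly P x / (1 + x\<^sup>2)) \<le> norm (poly P x)"
    by (auto simp: field_simps abs_mult add_pos_nonneg)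
qed measurable

lemma poly_square_div_pos:
  assumes "P \<noteq> 0"
  shows "(\<integral>x. (poly P x)\<^sup>2 / (1 + x\<^sup>2) \<partial>M) > 0"
proof -
  have int: "integrable M (\<lambda>x. (poly P x)\<^sup>2 / (1 + x\<^sup>2))"
    using integrable_poly_div[of "P\<^sup>2"] by simp
  have "(\<integral>x. (poly P x)\<^sup>2 / (1 + x\<^sup>2) \<partial>M) \<ge> 0" by simp
  moreover have "(\<integral>x. (poly P x)\<^sup>2 / (1 + x\<^sup>2) \<partial>M) \<noteq> 0"
  proof
    assume "(\<integral>x. (poly P x)\<^sup>2 / (1 + x\<^sup>2) \<partial>M) = 0"
    then have "AE x in M. (poly P x)\<^sup>2 / (1 + x\<^sup>2) = 0"
      using integral_nonneg_eq_0_iff_AE[OF int] by simp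
    then have "AE x in M. (poly P x)\<^sup>2 = 0"
      by eventually_elim (auto simp: add_nonneg_eq_0_iff)
    then have "(\<integral>x. (poly P x)\<^sup>2 \<partial>M) = 0" by (rule integral_eq_zero_AE)
    with poly_square_pos[OF assms] show False by simp
  qed
  ultimately show ?thesis by linarith
qed

text \<open>
  If the infimum were positive, then \<open>P \<mapsto> \<integral> P / (1 + x\<^sup>2) \<partial>M + \<alpha> Re P(\<i>)\<close> would still be positive on
  squares for small \<open>\<alpha> > 0\<close>, hence represented by some \<open>\<tau>\<close>. As \<open>1 + x\<^sup>2\<close> vanishes at \<open>\<i>\<close>, the
  measure \<open>(1 + x\<^sup>2) \<tau>\<close> has the moments of \<open>M\<close>, but it integrates \<open>1 / (1 + x\<^sup>2)\<close> differently.
\<close>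
lemma moment_determinate_imp_small_poly:
  assumes det: "moment_determinate M" and e: "\<epsilon> > 0"
  shows "\<exists>P. cmod (cpoly P \<i>) = 1 \<and> (\<integral>x. (poly P x)\<^sup>2 / (1 + x\<^sup>2) \<partial>M) < \<epsilon>"
proof (rule ccontr)
  assume "\<not> ?thesis"
  then have low: "(\<integral>x. (poly P x)\<^sup>2 / (1 + x\<^sup>2) \<partial>M) \<ge> \<epsilon>" if "cmod (cpoly P \<i>) = 1" for P
    using that by force
  \<comment> \<open>Both sides are quadratic in P, so the bound for
    \<open>\<bar>P(\<i>)\<bar> = 1\<close> extends by normalization.\<close>
  have low': "(\<integral>x. (poly P x)\<^sup>2 / (1 + x\<^sup>2) \<partial>M) \<ge> \<epsilon> * (cmod (cpoly P \<i>))\<^sup>2" for P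
  proof (cases "cpoly P \<i> = 0")
    case False
    define r where "r = cmod (cpoly P \<i>)"
    have r: "r > 0" using False by (simp add: r_def)
    have "\<epsilon> \<le> (\<integral>x. (poly (smult (1 / r) P) x)\<^sup>2 / (1 + x\<^sup>2) \<partial>M)"
      using r by (intro low) (simp add: cpoly_smult norm_divide norm_mult r_def)
    also have "\<dots> = (\<integral>x. (1 / r\<^sup>2) * ((poly P x)\<^sup>2 / (1 + x\<^sup>2)) \<partial>M)"
      by (intro Bochner_Integration.integral_cong) (auto simp: power_mult_distrib power_divide)
    also have "\<dots> = (1 / r\<^sup>2) * (\<integral>x. (poly P x)\<^sup>2 / (1 + x\<^sup>2) \<partial>M)"
      by (rule integral_mult_right_zero)
    finally show ?thesis using r by (simp add: field_simps r_def)
  qed simp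
  \<comment> \<open>The weight is half of what \<open>low'\<close> allows: as
    \<open>Re (P(\<i>)\<^sup>2) \<ge> - \<bar>P(\<i>)\<bar>\<^sup>2\<close>, at least half of the
    integral of \<open>P\<^sup>2 / (1 + x\<^sup>2)\<close> survives in
    \<open>L (P * P)\<close>.\<close>
  define L where "L P = (\<integral>x. poly P x / (1 + x\<^sup>2) \<partial>M) + \<epsilon> / 2 * Re (cpoly P \<i>)" for P
  have L_add: "L (P + Q) = L P + L Q" for P Q
    using integrable_poly_div[of P] integrable_poly_div[of Q]
    by (simp add: L_def cpoly_add add_divide_distrib algebra_simps)
  have L_smult: "L (smult c P) = c * L P" for c P
  proof -
    have "(\<integral>x. c * poly P x / (1 + x\<^sup>2) \<partial>M) = c * (\<integral>x. poly P x / (1 + x\<^sup>2) \<partial>M)"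
      using integral_mult_right_zero[of M c "\<lambda>x. poly P x / (1 + x\<^sup>2)"] by simp
    then show ?thesis by (simp add: L_def cpoly_smult algebra_simps)
  qed
  have L_pos: "L (P * P) > 0" if "P \<noteq> 0" for P
  proof -
    have "- Re (cpoly P \<i> * cpoly P \<i>) \<le> cmod (cpoly P \<i> * cpoly P \<i>)"
      using abs_Re_le_cmod[of "cpoly P \<i> * cpoly P \<i>"] by linarith
    also have "\<dots> = (cmod (cpoly P \<i>))\<^sup>2" by (simp add: norm_mult power2_eq_square)
    finally have "\<epsilon> * (- Re (cpoly P \<i> * cpoly P \<i>)) \<le> \<epsilon> * (cmod (cpoly P \<i>))\<^sup>2"
      using e by (intro mult_left_mono) auto
    also have "\<dots> \<le> (\<integral>x. (poly P x)\<^sup>2 / (1 + x\<^sup>2) \<partial>M)" by (rule low')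
    finally have "\<epsilon> * Re (cpoly P \<i> * cpoly P \<i>) \<ge> - (\<integral>x. (poly P x)\<^sup>2 / (1 + x\<^sup>2) \<partial>M)"
      by (simp only: mult_minus_right)
    moreover have "L (P * P) = (\<integral>x. (poly P x)\<^sup>2 / (1 + x\<^sup>2) \<partial>M) + \<epsilon> / 2 * Re (cpoly P \<i> * cpoly P \<i>)"
      by (simp add: L_def cpoly_mult power2_eq_square)
    ultimately show ?thesis using poly_square_div_pos[OF that] by simp
  qed
  \<comment> \<open>\<open>hamburger\<close> asks for total mass 1, hence the division by
    \<open>L 1\<close>; the factor c returns in the density of \<open>\<nu>\<close>.\<close>
  define c where "c = L 1"
  have c: "c > 0" using L_pos[of 1] by (simp add: c_def)
  interpret F: positive_functional "\<lambda>P. L P / c"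
    using c by unfold_locales (auto simp: L_add L_smult L_pos add_divide_distrib)
  obtain \<tau> where \<tau>: "real_distribution \<tau>" "\<And>k. integrable \<tau> (\<lambda>x. x ^ k)"
    and L: "\<And>P. (\<integral>x. poly P x \<partial>\<tau>) = L P / c"
    using F.hamburger c by (auto simp: c_def)
  interpret \<tau>: real_distribution \<tau> by fact
  have int\<tau>: "integrable \<tau> (\<lambda>x. poly P x)" for P
    unfolding poly_altdef by (intro Bochner_Integration.integrable_sum integrable_mult_right \<tau>)
  define \<nu> where "\<nu> = density \<tau> (\<lambda>x. ennreal (c * (1 + x\<^sup>2)))"
  have int\<nu>: "(\<integral>x. f x \<partial>\<nu>) = (\<integral>x. c * (1 + x\<^sup>2) * f x \<partial>\<tau>)"
    if [measurable]: "f \<in> borel_measurable borel" for f :: "real \<Rightarrow> real"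
    unfolding \<nu>_def using c by (subst integral_density) auto
  have poly\<nu>: "(\<integral>x. poly P x \<partial>\<nu>) = (\<integral>x. poly P x \<partial>M)" for P
  proof -
    have "(\<integral>x. poly P x \<partial>\<nu>) = (\<integral>x. poly (smult c ([:1, 0, 1:] * P)) x \<partial>\<tau>)"
      by (subst int\<nu>) (auto intro!: Bochner_Integration.integral_cong simp: power2_eq_square algebra_simps)
    also have "\<dots> = L ([:1, 0, 1:] * P)"
      unfolding L L_smult using c by simp
    also have "\<dots> = (\<integral>x. poly ([:1, 0, 1:] * P) x / (1 + x\<^sup>2) \<partial>M)"
      unfolding L_def cpoly_mult by simp
    also have "\<dots> = (\<integral>x. poly P x \<partial>M)"
    proof (intro Bochner_Integration.integral_cong refl)
      fix x :: real
      have "1 + x\<^sup>2 > 0" by (simp add: add_pos_nonneg)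
      moreover have "poly ([:1, 0, 1:] * P) x = poly P x * (1 + x\<^sup>2)"
        by (simp add: power2_eq_square algebra_simps)
      ultimately show "poly ([:1, 0, 1:] * P) x / (1 + x\<^sup>2) = poly P x"
        by simp
    qed
    finally show ?thesis .
  qed
  have prob\<nu>: "prob_space \<nu>"
  proof
    have "emeasure \<nu> (space \<nu>) = (\<integral>\<^sup>+x. ennreal (c * (1 + x\<^sup>2)) \<partial>\<tau>)"
      by (simp add: \<nu>_def emeasure_density)
    also have "\<dots> = ennreal (\<integral>x. c * (1 + x\<^sup>2) \<partial>\<tau>)"
      using c \<tau>(2) by (intro nn_integral_eq_integral) auto
    also have "(\<integral>x. c * (1 + x\<^sup>2) \<partial>\<tau>) = (\<integral>x. poly 1 x \<partial>\<nu>)"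
      by (subst int\<nu>) auto
    also have "\<dots> = 1" unfolding poly\<nu> using prob_space by (simp add: poly_1[abs_def])
    finally show "emeasure \<nu> (space \<nu>) = 1" by simp
  qed
  have power\<nu>: "integrable \<nu> (\<lambda>x. x ^ n)" for n
  proof -
    have "integrable \<tau> (\<lambda>x. c * (x ^ n + x ^ (n + 2)))"
      using \<tau>(2)[of n] \<tau>(2)[of "n + 2"] by (intro integrable_mult_right Bochner_Integration.integrable_add)
    also have "(\<lambda>x::real. c * (x ^ n + x ^ (n + 2))) = (\<lambda>x. (c * (1 + x\<^sup>2)) *\<^sub>R x ^ n)"
      by (auto simp: algebra_simps power2_eq_square)
    finally show ?thesis
      unfolding \<nu>_def using c by (subst integrable_density) auto
  qed
  have "(\<integral>x. x ^ n \<partial>\<nu>) = (\<integral>x. x ^ n \<partial>M)" for n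
    using poly\<nu>[of "monom 1 n"] by (simp add: poly_monom)
  moreover have "sets \<nu> = sets borel" by (simp add: \<nu>_def)
  ultimately have "\<nu> = M"
    using det prob\<nu> power\<nu> unfolding moment_determinate_def by blast
  then have "(\<integral>x. 1 / (1 + x\<^sup>2) \<partial>M) = (\<integral>x. 1 / (1 + x\<^sup>2) \<partial>\<nu>)" by simp
  also have "\<dots> = (\<integral>x. c * (1 + x\<^sup>2) * (1 / (1 + x\<^sup>2)) \<partial>\<tau>)"
    by (rule int\<nu>) measurable
  also have "\<dots> = (\<integral>x. c \<partial>\<tau>)"
    by (intro Bochner_Integration.integral_cong) (auto simp: add_nonneg_eq_0_iff)
  also have "\<dots> = c" using \<tau>.prob_space by simp
  also have "c = (\<integral>x. 1 / (1 + x\<^sup>2) \<partial>M) + \<epsilon> / 2"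
    by (simp add: c_def L_def one_pCons)
  finally show False using e by simp
qed

section \<open>The closure of the polynomials in \<open>L\<^sub>2\<close>\<close>

definition square_integrable :: "(real \<Rightarrow> real) \<Rightarrow> bool" where
  "square_integrable f \<longleftrightarrow> f \<in> borel_measurable borel \<and> integrable M (\<lambda>x. (f x)\<^sup>2)"

lemma square_integrable_measurable: "square_integrable f \<Longrightarrow> f \<in> borel_measurable borel"
  by (simp add: square_integrable_def)

lemma square_integrable_bound:
  assumes "square_integrable g" "f \<in> borel_measurable borel" "\<And>x. \<bar>f x\<bar> \<le> \<bar>g x\<bar>"
  shows "square_integrable f"
proof -
  note [measurable] = assms(2)
  have "integrable M (\<lambda>x. (f x)\<^sup>2)"
  proof (rule Bochner_Integration.integrable_bound)
    show "integrable M (\<lambda>x. (g x)\<^sup>2)" using assms(1) by (simp add: square_integrable_def)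
    show "AE x in M. norm ((f x)\<^sup>2) \<le> norm ((g x)\<^sup>2)"
      using assms(3) by (auto simp: abs_le_square_iff)
  qed measurable
  with assms(2) show ?thesis by (simp add: square_integrable_def)
qed

lemma square_integrable_mult:
  assumes "square_integrable f" "square_integrable g"
  shows "integrable M (\<lambda>x. f x * g x)"
proof -
  note [measurable] = assms[THEN square_integrable_measurable]
  show ?thesis
  proof (rule Bochner_Integration.integrable_bound)
    show "integrable M (\<lambda>x. (f x)\<^sup>2 + (g x)\<^sup>2)"
      using assms by (auto simp: square_integrable_def)
    have "\<bar>u * v\<bar> \<le> u\<^sup>2 + v\<^sup>2" for u v :: real
    proof -
      have "0 \<le> (\<bar>u\<bar> - \<bar>v\<bar>)\<^sup>2" by simp
      then have "2 * \<bar>u * v\<bar> \<le> u\<^sup>2 + v\<^sup>2"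
        by (simp add: power2_eq_square abs_mult algebra_simps)
      then show ?thesis by linarith
    qed
    then show "AE x in M. norm (f x * g x) \<le> norm ((f x)\<^sup>2 + (g x)\<^sup>2)"
      by (intro AE_I2) (metis abs_ge_self order.trans real_norm_def)
  qed measurable
qed

lemma square_integrable_add:
  assumes "square_integrable f" "square_integrable g"
  shows "square_integrable (\<lambda>x. f x + g x)"
  using assms square_integrable_mult[OF assms]
  by (auto simp: square_integrable_def power2_sum mult.assoc)

lemma square_integrable_cmult:
  "square_integrable f \<Longrightarrow> square_integrable (\<lambda>x. c * f x)"
  by (auto simp: square_integrable_def power_mult_distrib)

lemma square_integrable_diff:
  assumes "square_integrable f" "square_integrable g"
  shows "square_integrable (\<lambda>x. f x - g x)"
  using square_integrable_add[OF assms(1) square_integrable_cmult[OF assms(2), of "-1"]] by simp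

lemma square_integrable_poly: "square_integrable (poly P)"
  using integrable_poly_power[of P 2] by (simp add: square_integrable_def)

lemma square_integrable_const: "square_integrable (\<lambda>x. c)"
  by (simp add: square_integrable_def)

text \<open>Replaces the triangle inequality at the level of squared distances; its factor 2 is the
  origin of the bounds \<open>\<epsilon> / 4\<close> below.\<close>

lemma integral_square_add_le:
  assumes "square_integrable f" "square_integrable g"
  shows "(\<integral>x. (f x + g x)\<^sup>2 \<partial>M) \<le> 2 * (\<integral>x. (f x)\<^sup>2 \<partial>M) + 2 * (\<integral>x. (g x)\<^sup>2 \<partial>M)"
proof -
  have "(\<integral>x. (f x + g x)\<^sup>2 \<partial>M) \<le> (\<integral>x. 2 * (f x)\<^sup>2 + 2 * (g x)\<^sup>2 \<partial>M)"
  proof (rule integral_mono)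
    show "(f x + g x)\<^sup>2 \<le> 2 * (f x)\<^sup>2 + 2 * (g x)\<^sup>2" for x
      using zero_le_power2[of "f x - g x"] by (simp add: power2_eq_square algebra_simps)
  qed (use assms square_integrable_add[OF assms] in \<open>auto simp: square_integrable_def\<close>)
  also have "\<dots> = 2 * (\<integral>x. (f x)\<^sup>2 \<partial>M) + 2 * (\<integral>x. (g x)\<^sup>2 \<partial>M)"
    using assms by (simp add: square_integrable_def)
  finally show ?thesis .
qed

definition poly_closure :: "(real \<Rightarrow> real) set" where
  "poly_closure = {f. square_integrable f \<and> (\<forall>\<epsilon>>0. \<exists>P. (\<integral>x. (f x - poly P x)\<^sup>2 \<partial>M) < \<epsilon>)}"

lemma poly_closure_square_integrable: "f \<in> poly_closure \<Longrightarrow> square_integrable f"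
  by (simp add: poly_closure_def)

lemma poly_closureD: "f \<in> poly_closure \<Longrightarrow> \<epsilon> > 0 \<Longrightarrow> \<exists>P. (\<integral>x. (f x - poly P x)\<^sup>2 \<partial>M) < \<epsilon>"
  by (simp add: poly_closure_def)

lemma poly_in_poly_closure: "poly P \<in> poly_closure"
proof -
  have "\<exists>Q. (\<integral>x. (poly P x - poly Q x)\<^sup>2 \<partial>M) < \<epsilon>" if "\<epsilon> > 0" for \<epsilon>
    using that by (intro exI[of _ P]) simp
  then show ?thesis by (simp add: poly_closure_def square_integrable_poly)
qed

lemma poly_in_poly_closureI: "(\<And>x. f x = poly P x) \<Longrightarrow> f \<in> poly_closure"
  using poly_in_poly_closure[of P] by (subst ext[of f "poly P"]) auto

lemma poly_closure_closed:
  assumes f: "square_integrable f"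
    and h: "\<And>\<epsilon>. \<epsilon> > 0 \<Longrightarrow> \<exists>h\<in>poly_closure. (\<integral>x. (f x - h x)\<^sup>2 \<partial>M) < \<epsilon>"
  shows "f \<in> poly_closure"
proof -
  have "\<exists>P. (\<integral>x. (f x - poly P x)\<^sup>2 \<partial>M) < \<epsilon>" if e: "\<epsilon> > 0" for \<epsilon>
  proof -
    obtain h where h: "h \<in> poly_closure" "(\<integral>x. (f x - h x)\<^sup>2 \<partial>M) < \<epsilon> / 4"
      using h[of "\<epsilon> / 4"] e by auto
    then obtain P where P: "(\<integral>x. (h x - poly P x)\<^sup>2 \<partial>M) < \<epsilon> / 4"
      using e poly_closureD[of h "\<epsilon> / 4"] by auto
    have "(\<integral>x. ((f x - h x) + (h x - poly P x))\<^sup>2 \<partial>M)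
        \<le> 2 * (\<integral>x. (f x - h x)\<^sup>2 \<partial>M) + 2 * (\<integral>x. (h x - poly P x)\<^sup>2 \<partial>M)"
      by (intro integral_square_add_le square_integrable_diff f square_integrable_poly
          poly_closure_square_integrable h(1))
    with h P have "(\<integral>x. (f x - poly P x)\<^sup>2 \<partial>M) < \<epsilon>" by simp
    then show ?thesis by blast
  qed
  with f show ?thesis by (simp add: poly_closure_def)
qed

lemma poly_closure_add:
  assumes "f \<in> poly_closure" "g \<in> poly_closure"
  shows "(\<lambda>x. f x + g x) \<in> poly_closure"
proof (rule poly_closure_closed)
  note sq = assms[THEN poly_closure_square_integrable]
  show "square_integrable (\<lambda>x. f x + g x)" by (intro square_integrable_add sq)
  fix \<epsilon> :: real assume e: "\<epsilon> > 0"
  obtain P where P: "(\<integral>x. (f x - poly P x)\<^sup>2 \<partial>M) < \<epsilon> / 4"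
    using assms(1) e poly_closureD[of f "\<epsilon> / 4"] by auto
  obtain Q where Q: "(\<integral>x. (g x - poly Q x)\<^sup>2 \<partial>M) < \<epsilon> / 4"
    using assms(2) e poly_closureD[of g "\<epsilon> / 4"] by auto
  have "(\<integral>x. ((f x - poly P x) + (g x - poly Q x))\<^sup>2 \<partial>M)
      \<le> 2 * (\<integral>x. (f x - poly P x)\<^sup>2 \<partial>M) + 2 * (\<integral>x. (g x - poly Q x)\<^sup>2 \<partial>M)"
    by (intro integral_square_add_le square_integrable_diff sq square_integrable_poly)
  with P Q have "(\<integral>x. (f x + g x - poly (P + Q) x)\<^sup>2 \<partial>M) < \<epsilon>"
    by (simp add: algebra_simps)
  then show "\<exists>h\<in>poly_closure. (\<integral>x. (f x + g x - h x)\<^sup>2 \<partial>M) < \<epsilon>"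
    using poly_in_poly_closure by blast
qed

text \<open>Multiplication by a function bounded by C is continuous in \<open>L\<^sub>2\<close>, so
  it preserves the closure as soon as it sends polynomials into it.\<close>

lemma poly_closure_mult:
  assumes f: "f \<in> poly_closure" and [measurable]: "a \<in> borel_measurable borel"
    and a1: "\<And>x. \<bar>a x\<bar> \<le> C"
    and aP: "\<And>P. (\<lambda>x. a x * poly P x) \<in> poly_closure"
  shows "(\<lambda>x. a x * f x) \<in> poly_closure"
proof (rule poly_closure_closed)
  note sq = f[THEN poly_closure_square_integrable]
  have C: "C \<ge> 0" using a1[of 0] by linarith
  have bd: "square_integrable (\<lambda>x. a x * g x)" if "square_integrable g" for g
  proof (rule square_integrable_bound[OF square_integrable_cmult[OF that, of C]])
    show "(\<lambda>x. a x * g x) \<in> borel_measurable borel"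
      using that[THEN square_integrable_measurable] by measurable
    show "\<bar>a x * g x\<bar> \<le> \<bar>C * g x\<bar>" for x
      unfolding abs_mult using a1[of x] by (intro mult_right_mono) auto
  qed
  show "square_integrable (\<lambda>x. a x * f x)" by (rule bd[OF sq])
  fix \<epsilon> :: real assume e: "\<epsilon> > 0"
  \<comment> \<open>The summand 1 keeps the denominator positive when \<open>C = 0\<close>.\<close>
  define \<delta> where "\<delta> = \<epsilon> / (C\<^sup>2 + 1)"
  have d: "\<delta> > 0" using e by (simp add: \<delta>_def add_nonneg_pos)
  obtain P where P: "(\<integral>x. (f x - poly P x)\<^sup>2 \<partial>M) < \<delta>"
    using poly_closureD[OF f d] by blast
  have "(\<integral>x. (a x * f x - a x * poly P x)\<^sup>2 \<partial>M) \<le> (\<integral>x. C\<^sup>2 * (f x - poly P x)\<^sup>2 \<partial>M)"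
  proof (rule integral_mono)
    have sd: "square_integrable (\<lambda>x. f x - poly P x)"
      by (intro square_integrable_diff sq square_integrable_poly)
    show "integrable M (\<lambda>x. C\<^sup>2 * (f x - poly P x)\<^sup>2)"
      using sd by (simp add: square_integrable_def)
    show "integrable M (\<lambda>x. (a x * f x - a x * poly P x)\<^sup>2)"
      using bd[OF sd] by (simp add: square_integrable_def algebra_simps)
    show "(a x * f x - a x * poly P x)\<^sup>2 \<le> C\<^sup>2 * (f x - poly P x)\<^sup>2" for x
    proof -
      have "(a x)\<^sup>2 \<le> C\<^sup>2" using a1[of x] C by (intro abs_le_square_iff[THEN iffD1]) auto
      then have "(a x)\<^sup>2 * (f x - poly P x)\<^sup>2 \<le> C\<^sup>2 * (f x - poly P x)\<^sup>2"
        by (intro mult_right_mono) auto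
      then show ?thesis by (simp only: right_diff_distrib[symmetric] power_mult_distrib)
    qed
  qed
  also have "\<dots> \<le> C\<^sup>2 * \<delta>" using P by (simp add: mult_left_mono)
  also have "\<dots> < (C\<^sup>2 + 1) * \<delta>" using d by (intro mult_strict_right_mono) auto
  also have "\<dots> = \<epsilon>" using e by (simp add: \<delta>_def add_nonneg_eq_0_iff)
  finally show "\<exists>h\<in>poly_closure. (\<integral>x. (a x * f x - h x)\<^sup>2 \<partial>M) < \<epsilon>"
    using aP by (intro bexI[of _ "\<lambda>x. a x * poly P x"]) auto
qed

lemma poly_closure_cmult: "f \<in> poly_closure \<Longrightarrow> (\<lambda>x. c * f x) \<in> poly_closure"
proof (rule poly_closure_mult[where C = "\<bar>c\<bar>"])
  show "(\<lambda>x. c * poly P x) \<in> poly_closure" for P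
    by (rule poly_in_poly_closureI[of _ "smult c P"]) simp
qed auto

lemma poly_closure_const: "(\<lambda>x. c) \<in> poly_closure"
  by (rule poly_in_poly_closureI[of _ "[:c:]"]) simp

lemma poly_closure_diff:
  assumes "f \<in> poly_closure" "g \<in> poly_closure"
  shows "(\<lambda>x. f x - g x) \<in> poly_closure"
  using poly_closure_add[OF assms(1) poly_closure_cmult[OF assms(2), of "-1"]] by simp

lemma poly_closure_sum:
  assumes "\<And>i. i \<in> A \<Longrightarrow> f i \<in> poly_closure"
  shows "(\<lambda>x. \<Sum>i\<in>A. f i x) \<in> poly_closure"
  using assms
proof (induction A rule: infinite_finite_induct)
  case (insert i A)
  then show ?case by (simp add: poly_closure_add)
qed (simp_all add: poly_closure_const)

text \<open>The limit f inherits the bound of the \<open>h n\<close>, so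
  \<open>4 * (w x)\<^sup>2\<close> dominates the squared differences and pointwise convergence
  becomes convergence in mean square.\<close>

lemma poly_closure_dominated_limit:
  assumes h: "\<And>n::nat. h n \<in> poly_closure" and w: "square_integrable w"
    and f: "f \<in> borel_measurable borel"
    and bd: "\<And>n x. \<bar>h n x\<bar> \<le> \<bar>w x\<bar>" and lim: "\<And>x. (\<lambda>n. h n x) \<longlonglongrightarrow> f x"
  shows "f \<in> poly_closure"
proof (rule poly_closure_closed)
  note [measurable] = f w[THEN square_integrable_measurable]
    h[THEN poly_closure_square_integrable, THEN square_integrable_measurable]
  have fw: "\<bar>f x\<bar> \<le> \<bar>w x\<bar>" for x
    using LIMSEQ_le_const2[OF tendsto_rabs[OF lim[of x]], of "\<bar>w x\<bar>"] bd by blast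
  show "square_integrable f" by (rule square_integrable_bound[OF w f fw])
  have "(\<lambda>n. \<integral>x. (f x - h n x)\<^sup>2 \<partial>M) \<longlonglongrightarrow> (\<integral>x. 0 \<partial>M)"
  proof (rule integral_dominated_convergence)
    show "integrable M (\<lambda>x. 4 * (w x)\<^sup>2)" using w by (simp add: square_integrable_def)
    show "AE x in M. (\<lambda>n. (f x - h n x)\<^sup>2) \<longlonglongrightarrow> 0"
      by (rule AE_I2, rule tendsto_eq_intros, rule tendsto_diff[OF tendsto_const lim]) simp
    show "AE x in M. norm ((f x - h n x)\<^sup>2) \<le> 4 * (w x)\<^sup>2" for n
    proof (rule AE_I2)
      fix x
      have "\<bar>f x - h n x\<bar> \<le> \<bar>2 * w x\<bar>" using fw[of x] bd[of n x] by linarith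
      then have "(f x - h n x)\<^sup>2 \<le> (2 * w x)\<^sup>2" by (simp only: abs_le_square_iff)
      then show "norm ((f x - h n x)\<^sup>2) \<le> 4 * (w x)\<^sup>2" by (simp add: power_mult_distrib)
    qed
  qed measurable
  then have L0: "(\<lambda>n. \<integral>x. (f x - h n x)\<^sup>2 \<partial>M) \<longlonglongrightarrow> 0" by simp
  fix \<epsilon> :: real assume "\<epsilon> > 0"
  with L0 have "\<forall>\<^sub>F n in sequentially. (\<integral>x. (f x - h n x)\<^sup>2 \<partial>M) < \<epsilon>"
    by (rule order_tendstoD(2))
  then obtain n where "(\<integral>x. (f x - h n x)\<^sup>2 \<partial>M) < \<epsilon>"
    by (auto dest: eventually_happens)
  then show "\<exists>h\<in>poly_closure. (\<integral>x. (f x - h x)\<^sup>2 \<partial>M) < \<epsilon>"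
    using h by blast
qed

section \<open>Bounded multipliers and Stone--Weierstrass\<close>

lemma square_integrable_cay: "square_integrable cay1" "square_integrable cay2"
  by (rule square_integrable_bound[OF square_integrable_const[of 1]]; simp add: abs_cay1_le abs_cay2_le)+

text \<open>
  With \<open>P(\<i>) = u + \<i> v\<close> of modulus 1, dividing \<open>P\<close> by \<open>1 + x\<^sup>2\<close> shows that \<open>u cay1 P - v cay2 P\<close> and
  \<open>v cay1 P + u cay2 P\<close> differ from \<open>cay1\<close> and \<open>cay2\<close> by polynomials, while both are bounded by
  \<open>\<bar>P\<bar> / sqrt (1 + x\<^sup>2)\<close>.
\<close>
lemma cay_in_poly_closure:
  assumes det: "moment_determinate M"
  shows "cay1 \<in> poly_closure" "cay2 \<in> poly_closure"
proof -
  have "\<exists>A B. (\<integral>x. (cay1 x - poly A x)\<^sup>2 \<partial>M) < \<epsilon> \<and> (\<integral>x. (cay2 x - poly B x)\<^sup>2 \<partial>M) < \<epsilon>"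
    if e: "\<epsilon> > 0" for \<epsilon>
  proof -
    obtain P where P1: "cmod (cpoly P \<i>) = 1" and P: "(\<integral>x. (poly P x)\<^sup>2 / (1 + x\<^sup>2) \<partial>M) < \<epsilon>"
      using moment_determinate_imp_small_poly[OF det e] by blast
    define u v where "u = Re (cpoly P \<i>)" and "v = Im (cpoly P \<i>)"
    have uv: "u\<^sup>2 + v\<^sup>2 = 1" using P1 by (simp add: u_def v_def cmod_def)
    obtain Q where aP: "\<And>x. cay1 x * poly P x = poly Q x + (u * cay1 x + v * cay2 x)"
      and bP: "\<And>x. cay2 x * poly P x = x * poly Q x + (u * cay2 x + v * (1 - cay1 x))"
      using cay_mult_poly[of P] unfolding u_def v_def by blast
    \<comment> \<open>In each combination of the two identities one of \<open>cay1\<close>,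
      \<open>cay2\<close> cancels and the other gets the coefficient
      \<open>u\<^sup>2 + v\<^sup>2 = 1\<close>; A and B are the negatives of the polynomial parts
      that remain, with \<open>pCons 0 Q\<close> standing for \<open>x * Q\<close>.\<close>
    define A where "A = - (smult u Q - smult v (pCons 0 Q) - [:v\<^sup>2:])"
    define B where "B = - (smult v Q + smult u (pCons 0 Q) + [:u * v:])"
    have dA: "cay1 x - poly A x = (u * cay1 x - v * cay2 x) * poly P x" for x
    proof -
      have "(u * cay1 x - v * cay2 x) * poly P x = u * (cay1 x * poly P x) - v * (cay2 x * poly P x)"
        by (simp add: algebra_simps)
      also have "\<dots> = (u\<^sup>2 + v\<^sup>2) * cay1 x - poly A x"
        unfolding aP bP A_def by (simp add: algebra_simps power2_eq_square)
      finally show ?thesis by (simp add: uv)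
    qed
    have dB: "cay2 x - poly B x = (v * cay1 x + u * cay2 x) * poly P x" for x
    proof -
      have "(v * cay1 x + u * cay2 x) * poly P x = v * (cay1 x * poly P x) + u * (cay2 x * poly P x)"
        by (simp add: algebra_simps)
      also have "\<dots> = (u\<^sup>2 + v\<^sup>2) * cay2 x - poly B x"
        unfolding aP bP B_def by (simp add: algebra_simps power2_eq_square)
      finally show ?thesis by (simp add: uv)
    qed
    have le: "(u' * cay1 x + v' * cay2 x)\<^sup>2 * (poly P x)\<^sup>2 \<le> (poly P x)\<^sup>2 / (1 + x\<^sup>2)"
      if "u'\<^sup>2 + v'\<^sup>2 = 1" for u' v' x
    proof -
      have "(u' * cay1 x + v' * cay2 x)\<^sup>2 + (u' * cay2 x - v' * cay1 x)\<^sup>2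
          = (u'\<^sup>2 + v'\<^sup>2) * ((cay1 x)\<^sup>2 + (cay2 x)\<^sup>2)"
        by (simp add: power2_eq_square algebra_simps)
      also have "\<dots> = cay1 x" by (simp only: that cay_circle)
      finally have "(u' * cay1 x + v' * cay2 x)\<^sup>2 \<le> cay1 x"
        using zero_le_power2[of "u' * cay2 x - v' * cay1 x"] by linarith
      then have "(u' * cay1 x + v' * cay2 x)\<^sup>2 * (poly P x)\<^sup>2 \<le> cay1 x * (poly P x)\<^sup>2"
        by (intro mult_right_mono) auto
      then show ?thesis by (simp add: cay1_def)
    qed
    have int: "integrable M (\<lambda>x. (poly P x)\<^sup>2 / (1 + x\<^sup>2))"
      using integrable_poly_div[of "P\<^sup>2"] by simp
    have sqA: "integrable M (\<lambda>x. (cay1 x - poly A x)\<^sup>2)"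
      using square_integrable_diff[OF square_integrable_cay(1) square_integrable_poly[of A]]
      by (simp add: square_integrable_def)
    have sqB: "integrable M (\<lambda>x. (cay2 x - poly B x)\<^sup>2)"
      using square_integrable_diff[OF square_integrable_cay(2) square_integrable_poly[of B]]
      by (simp add: square_integrable_def)
    have "(\<integral>x. (cay1 x - poly A x)\<^sup>2 \<partial>M) \<le> (\<integral>x. (poly P x)\<^sup>2 / (1 + x\<^sup>2) \<partial>M)"
    proof (rule integral_mono[OF sqA int])
      show "(cay1 x - poly A x)\<^sup>2 \<le> (poly P x)\<^sup>2 / (1 + x\<^sup>2)" for x
        unfolding dA power_mult_distrib using le[of u "- v" x] uv by simp
    qed
    moreover have "(\<integral>x. (cay2 x - poly B x)\<^sup>2 \<partial>M) \<le> (\<integral>x. (poly P x)\<^sup>2 / (1 + x\<^sup>2) \<partial>M)"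
    proof (rule integral_mono[OF sqB int])
      show "(cay2 x - poly B x)\<^sup>2 \<le> (poly P x)\<^sup>2 / (1 + x\<^sup>2)" for x
        unfolding dB power_mult_distrib using le[of v u x] uv by (simp add: add.commute)
    qed
    ultimately show ?thesis using P by (intro exI[of _ A] exI[of _ B]) linarith
  qed
  then show "cay1 \<in> poly_closure" "cay2 \<in> poly_closure"
    using square_integrable_cay unfolding poly_closure_def by blast+
qed

lemma cay_mult_poly_closure:
  assumes det: "moment_determinate M" and f: "f \<in> poly_closure"
  shows "(\<lambda>x. cay1 x * f x) \<in> poly_closure" "(\<lambda>x. cay2 x * f x) \<in> poly_closure"
proof -
  note cay = cay_in_poly_closure[OF det]
  have 1: "(\<lambda>x. cay1 x * poly P x) \<in> poly_closure"
    and 2: "(\<lambda>x. cay2 x * poly P x) \<in> poly_closure" for P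
  proof -
    define u v where "u = Re (cpoly P \<i>)" and "v = Im (cpoly P \<i>)"
    obtain Q where aP: "\<And>x. cay1 x * poly P x = poly Q x + (u * cay1 x + v * cay2 x)"
      and bP: "\<And>x. cay2 x * poly P x = x * poly Q x + (u * cay2 x + v * (1 - cay1 x))"
      using cay_mult_poly[of P] unfolding u_def v_def by blast
    have poly_x: "poly (pCons 0 Q) x = x * poly Q x" for x by simp
    show "(\<lambda>x. cay1 x * poly P x) \<in> poly_closure"
      unfolding aP by (intro poly_closure_add poly_closure_cmult cay poly_in_poly_closure)
    show "(\<lambda>x. cay2 x * poly P x) \<in> poly_closure"
      unfolding bP poly_x[symmetric]
      by (intro poly_closure_add poly_closure_cmult poly_closure_diff poly_closure_const cay poly_in_poly_closure)
  qed
  show "(\<lambda>x. cay1 x * f x) \<in> poly_closure"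
    by (rule poly_closure_mult[OF f _ abs_cay1_le 1]) measurable
  show "(\<lambda>x. cay2 x * f x) \<in> poly_closure"
    by (rule poly_closure_mult[OF f _ abs_cay2_le 2]) measurable
qed

text \<open>The closure need not be an algebra, so g acts as a multiplier: with h arbitrary, a
  product of polynomial functions is handled by two successive uses of the induction
  hypotheses.\<close>

lemma polynomial_cay_mult_poly_closure:
  assumes det: "moment_determinate M" and "real_polynomial_function g" and "h \<in> poly_closure"
  shows "(\<lambda>x. g (cay x) * h x) \<in> poly_closure"
  using assms(2,3)
proof (induction arbitrary: h rule: real_polynomial_function.induct)
  case (linear f)
  then interpret bounded_linear f by simp
  have "f (cay x) = f (1, 0) * cay1 x + f (0, 1) * cay2 x" for x
  proof -
    have "cay x = cay1 x *\<^sub>R (1, 0) + cay2 x *\<^sub>R (0, 1)" by (simp add: cay_def)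
    then show ?thesis by (simp only: add scaleR) simp
  qed
  then have "(\<lambda>x. f (cay x) * h x) = (\<lambda>x. f (1, 0) * (cay1 x * h x) + f (0, 1) * (cay2 x * h x))"
    by (simp add: fun_eq_iff algebra_simps)
  then show ?case
    using cay_mult_poly_closure[OF det linear.prems] by (simp add: poly_closure_add poly_closure_cmult)
next
  case (mult f g)
  show ?case
    using mult.IH(1)[OF mult.IH(2)[OF mult.prems]] by (simp add: mult.assoc)
qed (simp_all add: poly_closure_cmult distrib_right poly_closure_add)

text \<open>The range of \<open>cay\<close> lies in a compact square, where Stone--Weierstrass
  approximates uniformly; for a probability measure this controls the mean square.\<close>

lemma continuous_cay_poly_closure:
  fixes H :: "real \<times> real \<Rightarrow> real"
  assumes det: "moment_determinate M" and H: "continuous_on UNIV H"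
    and bd: "\<And>z. \<bar>H z\<bar> \<le> C"
  shows "(\<lambda>x. H (cay x)) \<in> poly_closure"
proof (rule poly_closure_closed)
  have [measurable]: "cay \<in> borel_measurable borel"
    unfolding cay_def by measurable
  have [measurable]: "H \<in> borel_measurable borel"
    using H by (rule borel_measurable_continuous_onI)
  show sqH: "square_integrable (\<lambda>x. H (cay x))"
    by (rule square_integrable_bound[OF square_integrable_const[of C]])
       (use bd order.trans[OF bd abs_ge_self] in auto)
  fix \<epsilon> :: real assume e: "\<epsilon> > 0"
  define \<delta> where "\<delta> = sqrt (\<epsilon> / 2)"
  have d: "\<delta> > 0" "\<delta>\<^sup>2 < \<epsilon>" using e by (simp_all add: \<delta>_def)
  have "compact (cbox (-1, -1) (1, 1) :: (real \<times> real) set)" by simp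
  moreover have "continuous_on (cbox (-1, -1) (1, 1)) H"
    using H by (rule continuous_on_subset) simp
  ultimately obtain g where g: "real_polynomial_function g"
    and gH: "\<And>z. z \<in> cbox (-1, -1) (1, 1) \<Longrightarrow> \<bar>H z - g z\<bar> < \<delta>"
    using Stone_Weierstrass_real_polynomial_function d(1) by metis
  have box: "cay x \<in> cbox (-1, -1) (1, 1)" for x
    using abs_cay1_le[of x] abs_cay2_le[of x] unfolding cay_def by (auto simp: cbox_Pair_eq)
  have gcl: "(\<lambda>x. g (cay x)) \<in> poly_closure"
    using polynomial_cay_mult_poly_closure[OF det g poly_closure_const[of 1]] by simp
  have "(\<integral>x. (H (cay x) - g (cay x))\<^sup>2 \<partial>M) \<le> (\<integral>x. \<delta>\<^sup>2 \<partial>M)"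
  proof (rule integral_mono)
    show "integrable M (\<lambda>x. (H (cay x) - g (cay x))\<^sup>2)"
      using square_integrable_diff[OF sqH poly_closure_square_integrable[OF gcl]]
      by (simp add: square_integrable_def)
    show "(H (cay x) - g (cay x))\<^sup>2 \<le> \<delta>\<^sup>2" for x
      using gH[OF box, of x] d(1) by (intro abs_le_square_iff[THEN iffD1]) auto
  qed simp
  also have "\<dots> < \<epsilon>" using d prob_space by simp
  finally show "\<exists>h\<in>poly_closure. (\<integral>x. (H (cay x) - h x)\<^sup>2 \<partial>M) < \<epsilon>"
    using gcl by (intro bexI[of _ "\<lambda>x. g (cay x)"])
qed

text \<open>Ever steeper functions of the distance to the compact image F decrease to its indicator,
  and injectivity of \<open>cay\<close> pulls this back to the interval. The distance is taken in
  the plane because the approximation available concerns continuous functions of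
  \<open>cay x\<close>.\<close>

lemma indicator_interval_poly_closure:
  assumes det: "moment_determinate M"
  shows "indicator {a..b} \<in> poly_closure"
proof (cases "a \<le> b")
  case True
  define F where "F = cay ` {a..b}"
  have "continuous_on {a..b} cay"
    unfolding cay_def cay1_def cay2_def
    by (intro continuous_intros) (auto simp: add_nonneg_eq_0_iff)
  then have "compact F" unfolding F_def by (intro compact_continuous_image) auto
  then have cl: "closed F" by (rule compact_imp_closed)
  have ne: "F \<noteq> {}" using True by (auto simp: F_def)
  define H where "H n z = max 0 (1 - real n * infdist z F)" for n z
  show ?thesis
  proof (rule poly_closure_dominated_limit)
    have "continuous_on UNIV (H n)" for n
      unfolding H_def by (intro continuous_intros)
    moreover have Hbd: "\<bar>H n z\<bar> \<le> 1" for n z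
      by (auto simp: H_def infdist_nonneg)
    ultimately show "(\<lambda>x. H n (cay x)) \<in> poly_closure" for n
      by (rule continuous_cay_poly_closure[OF det])
    show "square_integrable (\<lambda>x. 1)" by (rule square_integrable_const)
    show "\<bar>H n (cay x)\<bar> \<le> \<bar>1\<bar>" for n x using Hbd by simp
    show "indicator {a..b} \<in> borel_measurable borel" by measurable
    show "(\<lambda>n. H n (cay x)) \<longlonglongrightarrow> indicator {a..b} x" for x
    proof (cases "x \<in> {a..b}")
      case True
      then have "infdist (cay x) F = 0" by (simp add: F_def)
      with True show ?thesis by (simp add: H_def)
    next
      case False
      then have "cay x \<notin> F" by (auto simp: F_def dest: inj_cay)
      then have pos: "infdist (cay x) F > 0"
        using infdist_pos_not_in_closed[OF cl ne] by blast
      obtain N where N: "1 < real N * infdist (cay x) F"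
        using reals_Archimedean3[OF pos] by blast
      have "H n (cay x) = 0" if "n \<ge> N" for n
      proof -
        have "real N * infdist (cay x) F \<le> real n * infdist (cay x) F"
          using that pos by (intro mult_right_mono) auto
        with N show ?thesis by (simp add: H_def)
      qed
      then have "(\<lambda>n. H n (cay x)) \<longlonglongrightarrow> 0"
        by (intro tendsto_eventually) (auto simp: eventually_sequentially)
      with False show ?thesis by simp
    qed
  qed
next
  case False
  then have "indicator {a..b} = (\<lambda>x::real. 0::real)" by (auto simp: fun_eq_iff)
  then show ?thesis by (simp add: poly_closure_const)
qed

text \<open>Closed intervals, empty ones included, form a generator stable under intersection, so
  Dynkin's argument applies; a disjoint union is the limit of partial sums with values in
  \<open>{0, 1}\<close>.\<close>

lemma indicator_poly_closure:
  assumes det: "moment_determinate M" and B: "B \<in> sets borel"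
  shows "indicator B \<in> poly_closure"
proof -
  define G where "G = range (\<lambda>(a, b). {a..b::real})"
  have "Int_stable G"
    by (auto simp: Int_stable_def G_def)
  moreover have "G \<subseteq> Pow UNIV" by simp
  moreover have "B \<in> sigma_sets UNIV G"
    using B by (simp add: borel_eq_atLeastAtMost G_def)
  ultimately show ?thesis
  proof (induction rule: sigma_sets_induct_disjoint)
    case (basic A)
    then show ?case by (auto simp: G_def intro: indicator_interval_poly_closure[OF det])
  next
    case empty
    have "indicator {} = (\<lambda>x::real. 0::real)" by (simp add: fun_eq_iff)
    then show ?case by (simp add: poly_closure_const)
  next
    case (compl A)
    have "indicator (UNIV - A) = (\<lambda>x::real. 1 - indicator A x :: real)"
      by (auto simp: fun_eq_iff indicator_def)
    then show ?case using compl by (simp add: poly_closure_diff poly_closure_const)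
  next
    case (union A)
    have [measurable]: "A n \<in> sets borel" for n
      using union(2) by (auto simp: borel_eq_atLeastAtMost G_def)
    show ?case
    proof (rule poly_closure_dominated_limit)
      show "(\<lambda>x. \<Sum>i<n. indicator (A i) x) \<in> poly_closure" for n
        by (intro poly_closure_sum union)
      show "square_integrable (\<lambda>x. 1)" by (rule square_integrable_const)
      show "indicator (\<Union>i. A i) \<in> borel_measurable borel" by measurable
      have eq: "(\<Sum>i<n. indicator (A i) x) = (indicator (\<Union>i<n. A i) x :: real)" for n x
        using union(1) by (intro indicator_UN_disjoint[symmetric])
          (auto simp: disjoint_family_on_def)
      show "\<bar>\<Sum>i<n. indicator (A i) x\<bar> \<le> \<bar>1::real\<bar>" for n x
        unfolding eq by (simp add: indicator_def)
      show "(\<lambda>n. \<Sum>i<n. indicator (A i) x) \<longlonglongrightarrow> (indicator (\<Union>i. A i) x :: real)" for x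
        unfolding eq by (rule LIMSEQ_indicator_UN)
    qed
  qed
qed

theorem moment_determinate_imp_poly_dense:
  assumes det: "moment_determinate M" and f: "square_integrable f"
  shows "f \<in> poly_closure"
proof -
  have fm: "f \<in> borel_measurable M"
    using f[THEN square_integrable_measurable] by simp
  obtain s where s: "\<And>i. simple_function M (s i)" "\<And>x. (\<lambda>i. s i x) \<longlonglongrightarrow> f x"
    and sbd: "\<And>i x. \<bar>s i x\<bar> \<le> 2 * \<bar>f x\<bar>"
    using borel_measurable_implies_sequence_metric[OF fm, of 0] by (auto simp: dist_norm)
  have "s i \<in> poly_closure" for i
  proof -
    have eq: "s i = (\<lambda>x. \<Sum>y\<in>range (s i). y * indicator (s i -` {y}) x)"
    proof
      fix x
      have "(\<Sum>y\<in>range (s i). y * indicator (s i -` {y}) x) = (\<Sum>y\<in>range (s i). if y = s i x then y else 0)"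
        by (intro sum.cong) (auto simp: indicator_def)
      also have "\<dots> = s i x"
        using s(1)[of i] by (simp add: simple_function_def)
      finally show "s i x = (\<Sum>y\<in>range (s i). y * indicator (s i -` {y}) x)" by simp
    qed
    have "s i -` {y} \<in> sets borel" for y
      using simple_functionD(2)[OF s(1)[of i], of "{y}"] by simp
    then show ?thesis
      by (subst eq) (intro poly_closure_sum poly_closure_cmult indicator_poly_closure[OF det])
  qed
  then show ?thesis
    by (rule poly_closure_dominated_limit[where h = s and w = "\<lambda>x. 2 * f x"])
       (use s(2) sbd f square_integrable_cmult[OF f, of 2] in
         \<open>auto simp: abs_mult square_integrable_measurable\<close>)
qed

end

section \<open>Transition kernels and the expansion\<close>

context moment_distribution
begin

text \<open>The partial sum is the best approximation to f among the polynomials of degree below N,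
  so density forces convergence; expanding its squared error gives Bessel's inequality. The separate
  name \<open>c n\<close> lets \<open>poly (p n s) y\<close> be inserted for the
  coefficients.\<close>

lemma orthogonal_expansion_dense:
  assumes orth: "\<And>n m. (\<integral>x. poly (e n) x * poly (e m) x \<partial>M) = (if n = m then h n else 0)"
    and deg: "\<And>n. degree (e n) = n" and e0: "e 0 \<noteq> 0"
    and f: "f \<in> poly_closure" and c: "\<And>n. (\<integral>x. f x * poly (e n) x \<partial>M) = c n"
  shows "(\<lambda>N. \<integral>x. (f x - (\<Sum>n<N. poly (e n) x * c n / h n))\<^sup>2 \<partial>M) \<longlonglongrightarrow> 0"
    and "summable (\<lambda>n. (c n)\<^sup>2 / h n)"
proof -
  note sqf = poly_closure_square_integrable[OF f]
  have en: "e n \<noteq> 0" for n using deg[of n] e0 by (cases n) auto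
  have h: "h n > 0" for n
    using poly_square_pos[OF en[of n]] orth[of n n] by (simp add: power2_eq_square)
  have span: "\<exists>a. P = (\<Sum>k<N. smult (a k) (e k))" if "\<forall>k\<ge>N. coeff P k = 0" for N P
    using that
  proof (induction N arbitrary: P)
    case 0
    then show ?case by (auto intro: poly_eqI)
  next
    case (Suc N)
    define b where "b = coeff P N / coeff (e N) N"
    have "coeff (e N) N \<noteq> 0" using deg[of N] en[of N] by (metis leading_coeff_0_iff)
    moreover have "coeff (e N) k = 0" if "k > N" for k using that deg[of N] by (simp add: coeff_eq_0)
    moreover have "coeff P k = 0" if "k > N" for k using Suc.prems that Suc_leI by blast
    ultimately have "\<forall>k\<ge>N. coeff (P - smult b (e N)) k = 0"
      by (auto simp: b_def le_less)
    from Suc.IH[OF this] obtain a where a: "P - smult b (e N) = (\<Sum>k<N. smult (a k) (e k))" by blast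
    have "P = (\<Sum>k<Suc N. smult ((a(N := b)) k) (e k))"
      using a by (simp add: algebra_simps)
    then show ?case by blast
  qed
  define S where "S N = (\<Sum>n<N. smult (c n / h n) (e n))" for N
  have S: "poly (S N) x = (\<Sum>n<N. poly (e n) x * c n / h n)" for N x
    by (simp add: S_def poly_sum mult_ac)
  have Sdeg: "\<forall>k\<ge>N. coeff (S N) k = 0" for N
    by (auto simp: S_def coeff_sum coeff_eq_0 deg intro!: sum.neutral)
  have sqd: "square_integrable (\<lambda>x. f x - poly P x)" for P
    by (intro square_integrable_diff sqf square_integrable_poly)
  have ortho_e: "(\<integral>x. (f x - poly (S N) x) * poly (e k) x \<partial>M) = 0" if k: "k < N" for N k
  proof -
    have i: "integrable M (\<lambda>x. poly (e n) x * poly (e k) x)" for n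
      by (intro square_integrable_mult square_integrable_poly)
    have "(\<integral>x. poly (S N) x * poly (e k) x \<partial>M)
        = (\<integral>x. (\<Sum>n<N. c n / h n * (poly (e n) x * poly (e k) x)) \<partial>M)"
      by (simp add: S_def poly_sum sum_distrib_right mult.assoc)
    also have "\<dots> = (\<Sum>n<N. c n / h n * (if n = k then h n else 0))"
      by (simp add: i orth)
    also have "\<dots> = (\<Sum>n<N. if n = k then c n else 0)"
      using h by (intro sum.cong) (auto simp: less_imp_neq[symmetric])
    also have "\<dots> = c k" using k by simp
    finally show ?thesis
      using square_integrable_mult[OF sqf square_integrable_poly]
        square_integrable_mult[OF square_integrable_poly[of "S N"] square_integrable_poly]
      by (simp add: left_diff_distrib c)
  qed
  have ortho: "(\<integral>x. (f x - poly (S N) x) * poly P x \<partial>M) = 0" if P: "\<forall>k\<ge>N. coeff P k = 0" for N P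
  proof -
    obtain a where a: "P = (\<Sum>k<N. smult (a k) (e k))" using span[OF P] by blast
    have "(\<integral>x. (f x - poly (S N) x) * poly P x \<partial>M)
        = (\<integral>x. (\<Sum>k<N. a k * ((f x - poly (S N) x) * poly (e k) x)) \<partial>M)"
      unfolding a by (simp add: poly_sum sum_distrib_left mult.left_commute)
    also have "\<dots> = (\<Sum>k<N. a k * (\<integral>x. (f x - poly (S N) x) * poly (e k) x \<partial>M))"
      by (subst Bochner_Integration.integral_sum)
         (auto intro!: integrable_mult_right square_integrable_mult[OF sqd square_integrable_poly])
    also have "\<dots> = 0" using ortho_e by simp
    finally show ?thesis .
  qed
  have int2: "integrable M (\<lambda>x. (f x - poly P x)\<^sup>2)" for P
    using sqd[of P] by (simp add: square_integrable_def)
  \<comment> \<open>The cross term with \<open>S N - P\<close> integrates to zero, so it may be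
    added; the pointwise inequality then only discards the square of \<open>S N - P\<close>.\<close>
  have best: "(\<integral>x. (f x - poly (S N) x)\<^sup>2 \<partial>M) \<le> (\<integral>x. (f x - poly P x)\<^sup>2 \<partial>M)"
    if P: "\<forall>k\<ge>N. coeff P k = 0" for N P
  proof -
    have "(\<integral>x. (f x - poly (S N) x) * poly (S N - P) x \<partial>M) = 0"
      using P Sdeg by (intro ortho) auto
    moreover have i: "integrable M (\<lambda>x. (f x - poly (S N) x) * poly (S N - P) x)"
      by (intro square_integrable_mult sqd square_integrable_poly)
    ultimately have "(\<integral>x. (f x - poly (S N) x)\<^sup>2 \<partial>M)
        = (\<integral>x. (f x - poly (S N) x)\<^sup>2 + 2 * ((f x - poly (S N) x) * poly (S N - P) x) \<partial>M)"
      using int2 by simp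
    also have "\<dots> \<le> (\<integral>x. (f x - poly P x)\<^sup>2 \<partial>M)"
    proof (rule integral_mono)
      show "integrable M (\<lambda>x. (f x - poly (S N) x)\<^sup>2 + 2 * ((f x - poly (S N) x) * poly (S N - P) x))"
        using i int2 by (intro Bochner_Integration.integrable_add integrable_mult_right)
      show "(f x - poly (S N) x)\<^sup>2 + 2 * ((f x - poly (S N) x) * poly (S N - P) x) \<le> (f x - poly P x)\<^sup>2" for x
        using zero_le_power2[of "poly (S N) x - poly P x"]
        by (simp add: power2_eq_square algebra_simps)
    qed (rule int2)
    finally show ?thesis .
  qed
  have "(\<lambda>N. \<integral>x. (f x - poly (S N) x)\<^sup>2 \<partial>M) \<longlonglongrightarrow> 0"
  proof (rule LIMSEQ_I)
    fix r :: real assume "r > 0"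
    then obtain P where P: "(\<integral>x. (f x - poly P x)\<^sup>2 \<partial>M) < r" using poly_closureD[OF f] by blast
    have "norm ((\<integral>x. (f x - poly (S N) x)\<^sup>2 \<partial>M) - 0) < r" if "N \<ge> Suc (degree P)" for N
    proof -
      have "(\<integral>x. (f x - poly (S N) x)\<^sup>2 \<partial>M) \<le> (\<integral>x. (f x - poly P x)\<^sup>2 \<partial>M)"
        using that by (intro best) (auto simp: coeff_eq_0)
      moreover have "(\<integral>x. (f x - poly (S N) x)\<^sup>2 \<partial>M) \<ge> 0" by simp
      ultimately show ?thesis using P unfolding real_norm_def by linarith
    qed
    then show "\<exists>n0. \<forall>n\<ge>n0. norm ((\<integral>x. (f x - poly (S n) x)\<^sup>2 \<partial>M) - 0) < r" by blast
  qed
  then show "(\<lambda>N. \<integral>x. (f x - (\<Sum>n<N. poly (e n) x * c n / h n))\<^sup>2 \<partial>M) \<longlonglongrightarrow> 0"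
    by (simp add: S)
  show "summable (\<lambda>n. (c n)\<^sup>2 / h n)"
  proof (rule summableI_nonneg_bounded)
    show "0 \<le> (c n)\<^sup>2 / h n" for n using h[of n] by simp
    fix N
    have fi: "integrable M (\<lambda>x. f x * poly (e n) x)" for n
      by (intro square_integrable_mult sqf square_integrable_poly)
    have fS: "(\<integral>x. f x * poly (S N) x \<partial>M) = (\<Sum>n<N. (c n)\<^sup>2 / h n)"
    proof -
      have "(\<integral>x. f x * poly (S N) x \<partial>M) = (\<integral>x. (\<Sum>n<N. c n / h n * (f x * poly (e n) x)) \<partial>M)"
        by (simp add: S_def poly_sum sum_distrib_left mult_ac)
      also have "\<dots> = (\<Sum>n<N. (c n)\<^sup>2 / h n)"
        by (simp add: fi c power2_eq_square)
      finally show ?thesis .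
    qed
    have i1: "integrable M (\<lambda>x. f x * poly (S N) x)"
      and i2: "integrable M (\<lambda>x. (f x - poly (S N) x) * poly (S N) x)"
      by (intro square_integrable_mult sqd sqf square_integrable_poly)+
    have i3: "integrable M (\<lambda>x. (f x)\<^sup>2)" using sqf by (simp add: square_integrable_def)
    have "0 \<le> (\<integral>x. (f x - poly (S N) x)\<^sup>2 \<partial>M)" by simp
    \<comment> \<open>The last term integrates to zero, since \<open>S N\<close> lies in the span to
      which the error is orthogonal.\<close>
    also have "\<dots> = (\<integral>x. (f x)\<^sup>2 - f x * poly (S N) x - (f x - poly (S N) x) * poly (S N) x \<partial>M)"
      by (intro Bochner_Integration.integral_cong) (auto simp: power2_eq_square algebra_simps)
    also have "\<dots> = (\<integral>x. (f x)\<^sup>2 \<partial>M) - (\<Sum>n<N. (c n)\<^sup>2 / h n)"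
      using i1 i2 i3 ortho[OF Sdeg] fS by simp
    finally show "(\<Sum>n<N. (c n)\<^sup>2 / h n) \<le> (\<integral>x. (f x)\<^sup>2 \<partial>M)" by simp
  qed
qed

end

text \<open>The complement of the support is covered by the null members of a countable basis.
  Densities are supplied at points of the support, so almost every y has to be placed there.\<close>

lemma AE_in_msupp:
  fixes \<nu> :: "real measure"
  assumes [measurable_cong]: "sets \<nu> = sets borel"
  shows "AE x in \<nu>. x \<in> msupp \<nu>"
proof -
  obtain B :: "real set set" where B: "countable B" "\<And>b. b \<in> B \<Longrightarrow> open b"
    and basis: "\<And>U. open U \<Longrightarrow> \<exists>B'\<subseteq>B. \<Union>B' = U"
    by (metis ex_countable_basis topological_basis_def)
  have "AE x in \<nu>. \<forall>b\<in>{b\<in>B. emeasure \<nu> b = 0}. x \<notin> b"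
  proof (subst AE_ball_countable)
    show "countable {b \<in> B. emeasure \<nu> b = 0}" using B(1) by (rule countable_subset[rotated]) auto
    show "\<forall>b\<in>{b\<in>B. emeasure \<nu> b = 0}. AE x in \<nu>. x \<notin> b"
    proof
      fix b assume "b \<in> {b\<in>B. emeasure \<nu> b = 0}"
      then have "b \<in> null_sets \<nu>" using B(2) assms by (auto simp: null_sets_def)
      then show "AE x in \<nu>. x \<notin> b" by (rule AE_not_in)
    qed
  qed
  then show ?thesis
  proof eventually_elim
    case (elim x)
    show ?case unfolding msupp_def
    proof (intro CollectI allI impI)
      fix U assume U: "open U" "x \<in> U"
      then obtain b where b: "b \<in> B" "x \<in> b" "b \<subseteq> U" using basis[of U] by blast
      then have "0 < emeasure \<nu> b" using elim by (auto simp: zero_less_iff_neq_zero)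
      also have "\<dots> \<le> emeasure \<nu> U" using b U assms by (intro emeasure_mono) auto
      finally show "emeasure \<nu> U > 0" .
    qed
  qed
qed

text \<open>A nonzero polynomial has finitely many roots, so some support point is not a root, and
  the open set where P does not vanish has positive mass.\<close>

lemma poly_square_integral_pos:
  assumes sets: "sets \<nu> = sets borel" and int: "integrable \<nu> (\<lambda>x. (poly P x)\<^sup>2)"
    and inf: "infinite (msupp \<nu>)" and P: "P \<noteq> 0"
  shows "(\<integral>x. (poly P x)\<^sup>2 \<partial>\<nu>) > (0::real)"
proof -
  have "finite {x. poly P x = 0}" by (rule poly_roots_finite[OF P])
  then obtain x where x: "x \<in> msupp \<nu>" "poly P x \<noteq> 0"
    using inf by (metis (mono_tags, lifting) finite_subset mem_Collect_eq subsetI)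
  have "open {x. poly P x \<noteq> 0}"
    by (intro open_Collect_neq continuous_intros)
  then have pos: "emeasure \<nu> {x. poly P x \<noteq> 0} > 0"
    using x by (auto simp: msupp_def)
  have "(\<integral>x. (poly P x)\<^sup>2 \<partial>\<nu>) \<noteq> 0"
  proof
    assume "(\<integral>x. (poly P x)\<^sup>2 \<partial>\<nu>) = 0"
    then have "AE x in \<nu>. \<not> poly P x \<noteq> 0"
      using integral_nonneg_eq_0_iff_AE[OF int] by simp
    then have "emeasure \<nu> {x\<in>space \<nu>. \<not> \<not> poly P x \<noteq> 0} = 0"
      using AE_iff_measurable[of "{x\<in>space \<nu>. \<not> \<not> poly P x \<noteq> 0}" \<nu> "\<lambda>x. \<not> poly P x \<noteq> 0"]
        \<open>open {x. poly P x \<noteq> 0}\<close> sets sets_eq_imp_space_eq[OF sets] by auto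
    then show False using pos sets_eq_imp_space_eq[OF sets] by simp
  qed
  moreover have "(\<integral>x. (poly P x)\<^sup>2 \<partial>\<nu>) \<ge> 0" by simp
  ultimately show ?thesis by linarith
qed

lemma moment_distribution_law:
  assumes "prob_space M" "X t \<in> borel_measurable M" "standing_assms M I X" "t \<in> I"
  shows "moment_distribution (law M X t)"
proof -
  interpret prob_space M by fact
  interpret L: real_distribution "law M X t"
    unfolding law_def using assms(2) by (rule real_distribution_distr)
  have int: "integrable (law M X t) (\<lambda>x. x ^ k)" for k
    using assms by (simp add: law_def integrable_distr_eq standing_assms_def)
  show ?thesis
  proof
    show "integrable (law M X t) (\<lambda>x. x ^ k)" for k by (rule int)
    fix P :: "real poly" assume "P \<noteq> 0"
    have "integrable (law M X t) (\<lambda>x. poly (P\<^sup>2) x)"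
      unfolding poly_altdef by (intro Bochner_Integration.integrable_sum integrable_mult_right int)
    then show "(\<integral>x. (poly P x)\<^sup>2 \<partial>law M X t) > 0"
      using assms \<open>P \<noteq> 0\<close> by (intro poly_square_integral_pos) (auto simp: standing_assms_def)
  qed
qed

section \<open>Conditional expectations through the transition kernel\<close>

context
  fixes M :: "'a measure" and I X \<eta>
  assumes markov: "markov_process M I X \<eta>"
begin

interpretation prob_space M
  using markov by (simp add: markov_process_def)

lemma markov_measurable: "v \<in> I \<Longrightarrow> X v \<in> borel_measurable M"
  using markov by (simp add: markov_process_def)

lemma sets_past_algebra: "sets (past_algebra M I X s) =
    sigma_sets (space M) (\<Union>v\<in>{v\<in>I. v \<le> s}. {X v -` A \<inter> space M | A. A \<in> sets borel})"
  unfolding past_algebra_def by (rule sets_measure_of) auto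

lemma space_past_algebra: "space (past_algebra M I X s) = space M"
  unfolding past_algebra_def by (rule space_measure_of) auto

lemma subalgebra_past: "subalgebra M (past_algebra M I X s)"
proof -
  have "(\<Union>v\<in>{v\<in>I. v \<le> s}. {X v -` A \<inter> space M | A. A \<in> sets borel}) \<subseteq> sets M"
    using measurable_sets[OF markov_measurable] by auto
  then show ?thesis
    by (simp add: subalgebra_def sets_past_algebra space_past_algebra sets.sigma_sets_subset)
qed

lemma measurable_past: "s \<in> I \<Longrightarrow> X s \<in> borel_measurable (past_algebra M I X s)"
  by (rule measurableI) (auto simp: sets_past_algebra space_past_algebra intro!: sigma_sets.Basic)

lemma kernel_measurable:
  assumes "s \<in> I" "t \<in> I" "s \<le> t"
  shows "(\<lambda>y. \<eta> t y s) \<in> borel \<rightarrow>\<^sub>M subprob_algebra borel"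
proof (rule measurable_subprob_algebra)
  have p: "prob_space (\<eta> t y s)" and s: "sets (\<eta> t y s) = sets borel" for y
    using markov assms by (auto simp: markov_process_def)
  show "subprob_space (\<eta> t y s)" for y using p by (rule prob_space_imp_subprob_space)
  show "sets (\<eta> t y s) = sets borel" for y by (rule s)
  fix B :: "real set" assume "B \<in> sets borel"
  then have "(\<lambda>y. measure (\<eta> t y s) B) \<in> borel_measurable borel"
    using markov assms by (auto simp: markov_process_def)
  then have "(\<lambda>y. ennreal (measure (\<eta> t y s) B)) \<in> borel_measurable borel" by measurable
  also have "(\<lambda>y. ennreal (measure (\<eta> t y s) B)) = (\<lambda>y. emeasure (\<eta> t y s) B)"
    using p by (simp add: finite_measure.emeasure_eq_measure prob_space.finite_measure)
  finally show "(\<lambda>y. emeasure (\<eta> t y s) B) \<in> borel_measurable borel" .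
qed

text \<open>The Markov property is given for indicators. Restricted to a past event A, it says that
  the distribution of \<open>X t\<close> and the mixture of the kernels agree on Borel sets; as
  measures they are then equal and integrate every nonnegative g alike.\<close>

lemma nn_integral_past_kernel:
  assumes st: "s \<in> I" "t \<in> I" "s \<le> t"
    and A: "A \<in> sets (past_algebra M I X s)" and g [measurable]: "g \<in> borel_measurable borel"
  shows "(\<integral>\<^sup>+\<omega>\<in>A. g (X t \<omega>) \<partial>M) = (\<integral>\<^sup>+\<omega>\<in>A. (\<integral>\<^sup>+x. g x \<partial>\<eta> t (X s \<omega>) s) \<partial>M)"
proof -
  interpret F: finite_measure_subalgebra M "past_algebra M I X s"
    by unfold_locales (rule subalgebra_past)
  have [measurable]: "X t \<in> borel_measurable M" "X s \<in> borel_measurable M"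
    using st by (auto intro: markov_measurable)
  have AM [measurable]: "A \<in> sets M" using A subalgebra_past by (auto simp: subalgebra_def)
  note K = kernel_measurable[OF st]
  have [measurable]: "(\<lambda>\<omega>. \<eta> t (X s \<omega>) s) \<in> M \<rightarrow>\<^sub>M subprob_algebra borel"
    by (rule measurable_compose[OF _ K]) measurable
  have p: "prob_space (\<eta> t y s)" for y
    using markov st by (auto simp: markov_process_def)
  define MA where "MA = density M (indicator A)"
  have [simp]: "sets MA = sets M" "space MA = space M" by (simp_all add: MA_def)
  have KA: "(\<lambda>\<omega>. \<eta> t (X s \<omega>) s) \<in> MA \<rightarrow>\<^sub>M subprob_algebra borel"
    by (subst measurable_cong_sets[of MA M]) auto
  have XA: "X t \<in> borel_measurable MA"
    by (subst measurable_cong_sets[of MA M]) auto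
  have "distr MA borel (X t) = MA \<bind> (\<lambda>\<omega>. \<eta> t (X s \<omega>) s)"
  proof (rule measure_eqI)
    show "sets (distr MA borel (X t)) = sets (MA \<bind> (\<lambda>\<omega>. \<eta> t (X s \<omega>) s))"
      using not_empty sets_kernel[OF KA] by (subst sets_bind[where N = borel]) auto
    fix B assume "B \<in> sets (distr MA borel (X t))"
    then have B [measurable]: "B \<in> sets borel" by simp
    have iB: "integrable M (\<lambda>\<omega>. indicator B (X t \<omega>) :: real)"
      by (rule integrable_const_bound[of _ 1]) (auto simp: indicator_def)
    have ce: "AE \<omega> in M. real_cond_exp M (past_algebra M I X s) (\<lambda>\<omega>. indicator B (X t \<omega>)) \<omega>
        = measure (\<eta> t (X s \<omega>) s) B"
      using markov st B by (auto simp: markov_process_def)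
    have mK: "(\<lambda>\<omega>. measure (\<eta> t (X s \<omega>) s) B) \<in> borel_measurable M"
      using markov st B by (auto simp: markov_process_def intro: measurable_compose[of "X s" M borel])
    have "emeasure (distr MA borel (X t)) B = (\<integral>\<^sup>+\<omega>. indicator A \<omega> * indicator (X t -` B \<inter> space M) \<omega> \<partial>M)"
      using XA by (simp add: emeasure_distr MA_def emeasure_density)
    also have "\<dots> = (\<integral>\<^sup>+\<omega>. ennreal (indicator A \<omega> * indicator B (X t \<omega>)) \<partial>M)"
      by (intro nn_integral_cong) (auto simp: indicator_def)
    also have "\<dots> = ennreal (\<integral>\<omega>. indicator A \<omega> * indicator B (X t \<omega>) \<partial>M)"
      by (intro nn_integral_eq_integral integrable_const_bound[of _ 1]) (auto simp: indicator_def)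
    also have "(\<integral>\<omega>. indicator A \<omega> * indicator B (X t \<omega>) \<partial>M)
        = (\<integral>\<omega>. indicator A \<omega> * measure (\<eta> t (X s \<omega>) s) B \<partial>M)"
    proof -
      have "(\<integral>\<omega>\<in>A. indicator B (X t \<omega>) \<partial>M)
          = (\<integral>\<omega>\<in>A. real_cond_exp M (past_algebra M I X s) (\<lambda>\<omega>. indicator B (X t \<omega>)) \<omega> \<partial>M)"
        by (rule F.real_cond_exp_intA[OF iB A])
      also have "\<dots> = (\<integral>\<omega>\<in>A. measure (\<eta> t (X s \<omega>) s) B \<partial>M)"
        unfolding set_lebesgue_integral_def
        by (rule integral_cong_AE) (use ce mK in \<open>auto elim!: eventually_mono\<close>)
      finally show ?thesis by (simp add: set_lebesgue_integral_def)
    qed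
    also have "ennreal \<dots> = (\<integral>\<^sup>+\<omega>. ennreal (indicator A \<omega> * measure (\<eta> t (X s \<omega>) s) B) \<partial>M)"
    proof (intro nn_integral_eq_integral[symmetric] integrable_const_bound[of _ 1])
      show "AE \<omega> in M. norm (indicator A \<omega> * measure (\<eta> t (X s \<omega>) s) B) \<le> 1"
        using prob_space.prob_le_1[OF p] by (auto simp: indicator_def)
    qed (use mK in auto)
    also have "\<dots> = (\<integral>\<^sup>+\<omega>. indicator A \<omega> * emeasure (\<eta> t (X s \<omega>) s) B \<partial>M)"
      using p by (intro nn_integral_cong)
        (auto simp: indicator_def finite_measure.emeasure_eq_measure prob_space.finite_measure)
    also have "\<dots> = (\<integral>\<^sup>+\<omega>. emeasure (\<eta> t (X s \<omega>) s) B \<partial>MA)"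
      unfolding MA_def by (subst nn_integral_density) measurable
    also have "\<dots> = emeasure (MA \<bind> (\<lambda>\<omega>. \<eta> t (X s \<omega>) s)) B"
      using not_empty by (subst emeasure_bind[OF _ KA B]) auto
    finally show "emeasure (distr MA borel (X t)) B = emeasure (MA \<bind> (\<lambda>\<omega>. \<eta> t (X s \<omega>) s)) B" .
  qed
  then have "(\<integral>\<^sup>+x. g x \<partial>distr MA borel (X t)) = (\<integral>\<^sup>+x. g x \<partial>(MA \<bind> (\<lambda>\<omega>. \<eta> t (X s \<omega>) s)))" by simp
  also have "(\<integral>\<^sup>+x. g x \<partial>distr MA borel (X t)) = (\<integral>\<^sup>+\<omega>. g (X t \<omega>) \<partial>MA)"
    using XA by (rule nn_integral_distr) measurable
  also have "\<dots> = (\<integral>\<^sup>+\<omega>\<in>A. g (X t \<omega>) \<partial>M)"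
    unfolding MA_def by (subst nn_integral_density) (auto simp: mult.commute)
  also have "(\<integral>\<^sup>+x. g x \<partial>(MA \<bind> (\<lambda>\<omega>. \<eta> t (X s \<omega>) s))) = (\<integral>\<^sup>+\<omega>. (\<integral>\<^sup>+x. g x \<partial>\<eta> t (X s \<omega>) s) \<partial>MA)"
    by (rule nn_integral_bind[OF g KA])
  also have "\<dots> = (\<integral>\<^sup>+\<omega>\<in>A. (\<integral>\<^sup>+x. g x \<partial>\<eta> t (X s \<omega>) s) \<partial>M)"
    unfolding MA_def by (subst nn_integral_density)
      (auto simp: mult.commute intro!: measurable_compose[OF _ nn_integral_measurable_subprob_algebra[OF g]])
  finally show ?thesis .
qed

text \<open>\<open>real_cond_exp\<close> is the difference of the conditional expectations of
  positive and negative part, and each of these is characterized by its integrals over past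
  events.\<close>

lemma markov_real_cond_exp:
  assumes st: "s \<in> I" "t \<in> I" "s \<le> t"
    and f [measurable]: "f \<in> borel_measurable borel" and int: "integrable M (\<lambda>\<omega>. f (X t \<omega>))"
  shows "AE \<omega> in M. real_cond_exp M (past_algebra M I X s) (\<lambda>\<omega>. f (X t \<omega>)) \<omega>
           = (\<integral>x. f x \<partial>\<eta> t (X s \<omega>) s)"
proof -
  interpret F: finite_measure_subalgebra M "past_algebra M I X s"
    by unfold_locales (rule subalgebra_past)
  have [measurable]: "X t \<in> borel_measurable M" "X s \<in> borel_measurable M"
    using st by (auto intro: markov_measurable)
  have setsK: "sets (\<eta> t y s) = sets borel" for y
    using markov st by (auto simp: markov_process_def)
  have Gb: "(\<lambda>y. \<integral>\<^sup>+x. g x \<partial>\<eta> t y s) \<in> borel_measurable borel"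
    if "g \<in> borel_measurable borel" for g
    by (rule measurable_compose[OF kernel_measurable[OF st] nn_integral_measurable_subprob_algebra[OF that]])
  have G: "AE \<omega> in M. nn_cond_exp M (past_algebra M I X s) (\<lambda>\<omega>. g (X t \<omega>)) \<omega> = (\<integral>\<^sup>+x. g x \<partial>\<eta> t (X s \<omega>) s)"
    if g [measurable]: "g \<in> borel_measurable borel" for g
  proof (rule AE_symmetric[OF F.nn_cond_exp_charact])
    show "(\<lambda>\<omega>. \<integral>\<^sup>+x. g x \<partial>\<eta> t (X s \<omega>) s) \<in> borel_measurable (past_algebra M I X s)"
      by (rule measurable_compose[OF measurable_past[OF st(1)] Gb[OF g]])
  qed (use nn_integral_past_kernel[OF st _ g] in auto)
  \<comment> \<open>Almost sure finiteness makes f integrable against the kernel, so that its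
    Bochner integral is the difference of the two parts and not the default 0.\<close>
  have fin: "AE \<omega> in M. (\<integral>\<^sup>+x. g x \<partial>\<eta> t (X s \<omega>) s) \<noteq> \<infinity>"
    if g [measurable]: "g \<in> borel_measurable borel" and "(\<integral>\<^sup>+\<omega>. g (X t \<omega>) \<partial>M) \<noteq> \<infinity>" for g
  proof (rule nn_integral_PInf_AE)
    show "(\<lambda>\<omega>. \<integral>\<^sup>+x. g x \<partial>\<eta> t (X s \<omega>) s) \<in> borel_measurable M"
      by (rule measurable_compose[OF _ Gb[OF g]]) measurable
    have "space M \<in> sets (past_algebra M I X s)"
      by (metis sets.top space_past_algebra)
    from nn_integral_past_kernel[OF st this g]
    show "(\<integral>\<^sup>+\<omega>. (\<integral>\<^sup>+x. g x \<partial>\<eta> t (X s \<omega>) s) \<partial>M) \<noteq> \<infinity>"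
      using that(2) by (simp add: nn_integral_set_ennreal[symmetric] cong: nn_integral_cong)
  qed
  have f1: "(\<integral>\<^sup>+\<omega>. ennreal (f (X t \<omega>)) \<partial>M) \<noteq> \<infinity>" and f2: "(\<integral>\<^sup>+\<omega>. ennreal (- f (X t \<omega>)) \<partial>M) \<noteq> \<infinity>"
    using int by (simp_all add: real_integrable_def)
  have m1: "(\<lambda>x. ennreal (f x)) \<in> borel_measurable borel" and m2: "(\<lambda>x. ennreal (- f x)) \<in> borel_measurable borel"
    by measurable
  show ?thesis
    using G[OF m1] G[OF m2] fin[OF m1 f1] fin[OF m2 f2]
  proof eventually_elim
    case (elim \<omega>)
    have "f \<in> borel_measurable (\<eta> t (X s \<omega>) s)"
      by (subst measurable_cong_sets[OF setsK refl]) (rule f)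
    with elim have "integrable (\<eta> t (X s \<omega>) s) f"
      by (simp add: real_integrable_def)
    with elim show ?case
      by (simp add: real_cond_exp_def real_lebesgue_integral_def)
  qed
qed

end

text \<open>Passing from \<open>\<omega>\<close> to \<open>y = X s \<omega>\<close> needs a
  measurable exceptional set, hence measurability in y of the kernel integral.\<close>

lemma AE_integral_kernel_eq:
  assumes markov: "markov_process M I X \<eta>" and st: "s \<in> I" "t \<in> I" "s \<le> t"
    and f [measurable]: "f \<in> borel_measurable borel" and int: "integrable M (\<lambda>\<omega>. f (X t \<omega>))"
    and q [measurable]: "q \<in> borel_measurable borel"
    and ce: "AE \<omega> in M. real_cond_exp M (past_algebra M I X s) (\<lambda>\<omega>. f (X t \<omega>)) \<omega> = q (X s \<omega>)"
  shows "AE y in law M X s. (\<integral>x. f x \<partial>\<eta> t y s) = q y"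
proof -
  have [measurable]: "X s \<in> borel_measurable M"
    using markov_measurable[OF markov st(1)] .
  have [measurable]: "(\<lambda>y. \<integral>x. f x \<partial>\<eta> t y s) \<in> borel_measurable borel"
    by (rule measurable_compose[OF kernel_measurable[OF markov st] integral_measurable_subprob_algebra[OF f]])
  have "AE \<omega> in M. (\<integral>x. f x \<partial>\<eta> t (X s \<omega>) s) = q (X s \<omega>)"
    using ce markov_real_cond_exp[OF markov st f int] by eventually_elim simp
  then show ?thesis
    unfolding law_def by (subst AE_distr_iff) auto
qed

theorem theorem2:
  fixes M :: "'a measure" and I :: "real set" and X :: "real \<Rightarrow> 'a \<Rightarrow> real"
    and \<eta> :: "real \<Rightarrow> real \<Rightarrow> real \<Rightarrow> real measure"
    and p :: "nat \<Rightarrow> real \<Rightarrow> real poly" and phat :: "nat \<Rightarrow> real \<Rightarrow> real"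
    and \<phi> :: "real \<Rightarrow> real \<Rightarrow> real \<Rightarrow> real \<Rightarrow> real"
  assumes I: "is_interval I"
    and markov: "markov_process M I X \<eta>"
    and standing: "standing_assms M I X"
    and mpr: "poly_cond_moments M I X"
    and opm: "opm_polys M I X p phat"
    and ac: "\<And>s t y. s \<in> I \<Longrightarrow> t \<in> I \<Longrightarrow> s < t \<Longrightarrow> y \<in> msupp (law M X s) \<Longrightarrow>
              absolutely_continuous (law M X t) (\<eta> t y s) \<and>
              (\<lambda>x. \<phi> x t y s) \<in> borel_measurable borel \<and> (\<forall>x. 0 \<le> \<phi> x t y s) \<and>
              \<eta> t y s = density (law M X t) (\<lambda>x. ennreal (\<phi> x t y s)) \<and>
              integrable (law M X t) (\<lambda>x. (\<phi> x t y s)\<^sup>2)"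
  shows "\<forall>s\<in>I. \<forall>t\<in>I. s < t \<longrightarrow>
           (AE y in law M X s.
              ((\<lambda>N. \<integral>x. (\<phi> x t y s - (\<Sum>n<N. poly (p n t) x * poly (p n s) y / phat n t))\<^sup>2 \<partial>law M X t)
                 \<longlonglongrightarrow> 0) \<and>
              summable (\<lambda>n. (poly (p n s) y)\<^sup>2 / phat n t))"
proof (intro ballI impI)
  fix s t assume st: "s \<in> I" "t \<in> I" "s < t"
  have P: "prob_space M" using markov by (simp add: markov_process_def)
  have Xm [measurable]: "X t \<in> borel_measurable M" "X s \<in> borel_measurable M"
    using markov st by (simp_all add: markov_process_def)
  interpret L: moment_distribution "law M X t"
    by (rule moment_distribution_law[OF P Xm(1) standing st(2)])
  have det: "moment_determinate (law M X t)" using standing st by (simp add: standing_assms_def)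
  have orth: "(\<integral>x. poly (p n t) x * poly (p m t) x \<partial>law M X t) = (if n = m then phat n t else 0)" for n m
    using opm st unfolding law_def by (subst integral_distr) (auto simp: opm_polys_def)
  have deg: "degree (p n t) = n" and p0: "p 0 t \<noteq> 0" for n
    using opm st by (simp_all add: opm_polys_def)
  have "AE y in law M X s. (\<integral>x. poly (p n t) x \<partial>\<eta> t y s) = poly (p n s) y" for n
  proof (rule AE_integral_kernel_eq[OF markov st(1,2)])
    show "integrable M (\<lambda>\<omega>. poly (p n t) (X t \<omega>))"
      using L.integrable_poly[of "p n t"] by (simp add: law_def integrable_distr_eq)
    show "AE \<omega> in M. real_cond_exp M (past_algebra M I X s) (\<lambda>\<omega>. poly (p n t) (X t \<omega>)) \<omega> = poly (p n s) (X s \<omega>)"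
      using opm st by (auto simp: opm_polys_def)
  qed (use st L.borel_measurable_poly in auto)
  \<comment> \<open>A countable union of null sets is null, so a single y serves all coefficients at
    once.\<close>
  then have "AE y in law M X s. \<forall>n. (\<integral>x. poly (p n t) x \<partial>\<eta> t y s) = poly (p n s) y"
    by (simp add: AE_all_countable)
  moreover have "AE y in law M X s. y \<in> msupp (law M X s)"
    by (rule AE_in_msupp) (simp add: law_def)
  ultimately show "AE y in law M X s.
      ((\<lambda>N. \<integral>x. (\<phi> x t y s - (\<Sum>n<N. poly (p n t) x * poly (p n s) y / phat n t))\<^sup>2 \<partial>law M X t)
         \<longlonglongrightarrow> 0) \<and>
      summable (\<lambda>n. (poly (p n s) y)\<^sup>2 / phat n t)"
  proof eventually_elim
    case (elim y)
    note ac = ac[OF st elim(2)]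
    have sq: "L.square_integrable (\<lambda>x. \<phi> x t y s)"
      using ac by (simp add: L.square_integrable_def)
    have dens: "\<eta> t y s = density (law M X t) (\<lambda>x. ennreal (\<phi> x t y s))" using ac by blast
    have c: "(\<integral>x. \<phi> x t y s * poly (p n t) x \<partial>law M X t) = poly (p n s) y" for n
    proof -
      have "poly (p n s) y = (\<integral>x. poly (p n t) x \<partial>\<eta> t y s)" using elim(1) by simp
      also have "\<dots> = (\<integral>x. \<phi> x t y s * poly (p n t) x \<partial>law M X t)"
        unfolding dens using ac by (subst integral_density) auto
      finally show ?thesis by simp
    qed
    note dense = L.moment_determinate_imp_poly_dense[OF det sq]
    show ?case
      using L.orthogonal_expansion_dense[OF orth deg p0 dense c] by blast
  qed
qed
end
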